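(* Let $R$ be a ring, $\alpha$ an ordinal, and let $M$ be a right $R$-module with finite spanning dimension (an $fsd$-module). If $M$ is an irredundant sum of submodules each of which has Noetherian dimension $\le\alpha$, then $n\text{-}\dim M\le\alpha$.
   Context: Rings are associative with identity and modules are unital right modules. Ordinals are taken to begin with $-1$ (so $0$ is the successor of $-1$). Noetherian dimension (also called dual Krull dimension) $n\text{-}\dim M$: defined by transfinite recursion. $n\text{-}\dim M=-1$ iff $M=0$. For an ordinal $\alpha\ge 0$, $n\text{-}\dim M=\alpha$ iff $n\text{-}\dim M\not<\alpha$ and for every ascending chain $M_0\subseteq M_1\subseteq M_2\subseteq\cdots$ of submodules of $M$ there is $k$ with $n\text{-}\dim(M_{i+1}/M_i)<\alpha$ for all $i\ge k$. If no such ordinal exists, $M$ does not have Noetherian dimension. A statement such as $n\text{-}\dim X\le\alpha$ includes the assertion that $X$ has Noetherian dimension. A sum $M=\sum_{\delta\in\Delta}M_\delta$ of submodules is irredundant if $M\ne\sum_{\delta\ne\delta_0}M_\delta$ for every $\delta_0\in\Delta$. A submodule $N$ of $M$ is small ($N\ll M$) if for every submodule $L$ of $M$, $N+L=M$ implies $L=M$. $M$ has finite spanning dimension ($M$ is an $fsd$-module) if $M$ satisfies the descending chain condition on non-small submodules; equivalently, for every strictly descending chain $N_1\supsetneq N_2\supsetneq\cdots$ of submodules of $M$ there is $n$ such that $N_i\ll M$ for all $i>n$. *)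

theory Defs
  imports "HOL-Algebra.Module" "HOL-Algebra.AbelCoset"
begin

text \<open>The library locale \<^locale>\<open>module\<close> is restricted to commutative rings, so right modules over
  arbitrary rings are introduced here, on the library record of modules. The term
  \<open>a \<odot>\<^bsub>M\<^esub> x\<close> stands for the right action \<open>x a\<close>; this is visible in
  \<open>smult_assoc\<close>, which reads \<open>x (a b) = (x a) b\<close>.\<close>

locale right_module = R?: ring R + M?: abelian_group M
  for R :: "('r, 's) ring_scheme" (structure) and M :: "('r, 'm, 'e) module_scheme" (structure) +
  assumes smult_closed:
      "\<lbrakk>a \<in> carrier R; x \<in> carrier M\<rbrakk> \<Longrightarrow> a \<odot>\<^bsub>M\<^esub> x \<in> carrier M"
    and smult_l_distr:
      "\<lbrakk>a \<in> carrier R; b \<in> carrier R; x \<in> carrier M\<rbrakk> \<Longrightarrow>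
      (a \<oplus>\<^bsub>R\<^esub> b) \<odot>\<^bsub>M\<^esub> x = a \<odot>\<^bsub>M\<^esub> x \<oplus>\<^bsub>M\<^esub> b \<odot>\<^bsub>M\<^esub> x"
    and smult_r_distr:
      "\<lbrakk>a \<in> carrier R; x \<in> carrier M; y \<in> carrier M\<rbrakk> \<Longrightarrow>
      a \<odot>\<^bsub>M\<^esub> (x \<oplus>\<^bsub>M\<^esub> y) = a \<odot>\<^bsub>M\<^esub> x \<oplus>\<^bsub>M\<^esub> a \<odot>\<^bsub>M\<^esub> y"
    and smult_assoc:
      "\<lbrakk>a \<in> carrier R; b \<in> carrier R; x \<in> carrier M\<rbrakk> \<Longrightarrow>
      (a \<otimes>\<^bsub>R\<^esub> b) \<odot>\<^bsub>M\<^esub> x = b \<odot>\<^bsub>M\<^esub> (a \<odot>\<^bsub>M\<^esub> x)"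
    and smult_one:
      "x \<in> carrier M \<Longrightarrow> \<one>\<^bsub>R\<^esub> \<odot>\<^bsub>M\<^esub> x = x"

text \<open>The library predicate \<^const>\<open>submodule\<close> (an additive subgroup closed under the action) does not
  refer to commutativity or to the side of the action and is used as it stands. A submodule \<open>A\<close> of
  \<open>M\<close>, regarded as a module, is \<open>M\<lparr>carrier := A\<rparr>\<close>.\<close>

text \<open>The record of modules extends that of rings; its ring multiplication and unit play no role.\<close>

definition quotient_module ::
  "('r, 'm, 'e) module_scheme \<Rightarrow> 'm set \<Rightarrow> ('r, 'm set) module" where
  "quotient_module M N =
    \<lparr>carrier = a_rcosets\<^bsub>M\<^esub> N, mult = undefined, one = undefined,
     zero = N, add = (\<lambda>A B. A <+>\<^bsub>M\<^esub> B),
     smult = (\<lambda>a A. \<Union>x\<in>A. N +>\<^bsub>M\<^esub> (a \<odot>\<^bsub>M\<^esub> x))\<rparr>"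

definition module_isomorphic ::
  "('r, 's) ring_scheme \<Rightarrow> ('r, 'm, 'e) module_scheme \<Rightarrow> ('r, 'n, 'f) module_scheme \<Rightarrow> bool" where
  "module_isomorphic R M N \<longleftrightarrow>
    (\<exists>h. bij_betw h (carrier M) (carrier N) \<and>
      (\<forall>x\<in>carrier M. \<forall>y\<in>carrier M. h (x \<oplus>\<^bsub>M\<^esub> y) = h x \<oplus>\<^bsub>N\<^esub> h y) \<and>
      (\<forall>a\<in>carrier R. \<forall>x\<in>carrier M. h (a \<odot>\<^bsub>M\<^esub> x) = a \<odot>\<^bsub>N\<^esub> h x))"

text \<open>\<open>has_ndim R M \<alpha>\<close> says that the Noetherian dimension of \<open>M\<close> exists and equals \<open>\<alpha>\<close>.

  Ordinals are the elements of a well-ordered type. As they begin with \<open>-1\<close>, the least element of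
  the type is \<open>-1\<close>, its successor is \<open>0\<close>, and so on. A theorem with a free type variable of class
  \<^class>\<open>wellorder\<close> thus speaks about ordinals of arbitrary size.

  The recursion must stay within one type of modules, whereas the quotient of \<open>C (i + 1)\<close> by
  \<open>C i\<close> has elements of type \<open>'m set\<close>. Hence its dimension is taken on an isomorphic module
  \<open>Q\<close> with elements of type \<open>'m\<close>; such a \<open>Q\<close> always exists (choose representatives of the
  cosets).\<close>

function has_ndim ::
  "('r, 's) ring_scheme \<Rightarrow> ('r, 'm) module \<Rightarrow> 'o::wellorder \<Rightarrow> bool" where
  "has_ndim R M \<alpha> \<longleftrightarrow>
    (if \<forall>\<gamma>. \<alpha> \<le> \<gamma> then carrier M = {\<zero>\<^bsub>M\<^esub>}
     else
      \<not> (\<exists>\<beta>\<in>{..<\<alpha>}. has_ndim R M \<beta>) \<and>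
      (\<forall>C :: nat \<Rightarrow> 'm set.
        (\<forall>i. submodule (C i) R M) \<and> (\<forall>i. C i \<subseteq> C (Suc i)) \<longrightarrow>
        (\<exists>k. \<forall>i\<ge>k. \<exists>\<beta>\<in>{..<\<alpha>}. \<exists>Q :: ('r, 'm) module.
          right_module R Q \<and>
          module_isomorphic R Q (quotient_module (M\<lparr>carrier := C (Suc i)\<rparr>) (C i)) \<and>
          has_ndim R Q \<beta>)))"
  by pat_completeness auto
termination
  by (relation "inv_image {(\<beta>, \<alpha>). \<beta> < \<alpha>} (\<lambda>(R, M, \<alpha>). \<alpha>)") (auto intro: wf wf_inv_image)

declare has_ndim.simps [simp del]

definition ndim_le ::
  "('r, 's) ring_scheme \<Rightarrow> ('r, 'm) module \<Rightarrow> 'o::wellorder \<Rightarrow> bool" where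
  "ndim_le R M \<alpha> \<longleftrightarrow> (\<exists>\<beta>\<le>\<alpha>. has_ndim R M \<beta>)"

definition submodule_sum ::
  "('r, 'm, 'e) module_scheme \<Rightarrow> 'i set \<Rightarrow> ('i \<Rightarrow> 'm set) \<Rightarrow> 'm set" where
  "submodule_sum M \<Delta> N =
    {finsum M x F | F x. finite F \<and> F \<subseteq> \<Delta> \<and> (\<forall>\<delta>\<in>F. x \<delta> \<in> N \<delta>)}"

definition is_irredundant_sum ::
  "('r, 'm, 'e) module_scheme \<Rightarrow> 'i set \<Rightarrow> ('i \<Rightarrow> 'm set) \<Rightarrow> bool" where
  "is_irredundant_sum M \<Delta> N \<longleftrightarrow>
    carrier M = submodule_sum M \<Delta> N \<and>
    (\<forall>\<delta>\<^sub>0\<in>\<Delta>. carrier M \<noteq> submodule_sum M (\<Delta> - {\<delta>\<^sub>0}) N)"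

definition small_submodule ::
  "('r, 's) ring_scheme \<Rightarrow> ('r, 'm, 'e) module_scheme \<Rightarrow> 'm set \<Rightarrow> bool" where
  "small_submodule R M N \<longleftrightarrow>
    submodule N R M \<and>
    (\<forall>L. submodule L R M \<longrightarrow> N <+>\<^bsub>M\<^esub> L = carrier M \<longrightarrow> L = carrier M)"

definition finite_spanning_dimension ::
  "('r, 's) ring_scheme \<Rightarrow> ('r, 'm, 'e) module_scheme \<Rightarrow> bool" where
  "finite_spanning_dimension R M \<longleftrightarrow>
    (\<forall>N :: nat \<Rightarrow> 'm set.
      (\<forall>i. submodule (N i) R M \<and> \<not> small_submodule R M (N i)) \<and> (\<forall>i. N (Suc i) \<subseteq> N i) \<longrightarrow>
      (\<exists>n. \<forall>i\<ge>n. N i = N n))"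

end

theory Submission
  imports Defs
begin

text \<open>Two independent ideas combine.

  Finite spanning dimension forces an irredundant family to be finite. If \<open>\<delta>\<^sub>0, \<delta>\<^sub>1, \<dots>\<close> were distinct
  indices, let \<open>K\<^sub>n\<close> be the sum of all members except the first \<open>n\<close> of these. The omitted \<open>n\<close>
  members have a proper sum, by irredundancy, but together with \<open>K\<^sub>n\<close> they span the module; so no
  \<open>K\<^sub>n\<close> is small. Irredundancy also makes the chain strictly descending, which contradicts the chain
  condition on non-small submodules (\<open>fsd_irredundant_sum_finite\<close>).

  The modules of Noetherian dimension at most \<open>\<alpha>\<close> are closed under finite sums. This belongs to
  lattice theory. Since the submodules of \<open>B / A\<close> are the submodules between \<open>A\<close> and \<open>B\<close>, the
  dimension of \<open>B / A\<close> is determined by the interval \<open>[A, B]\<close> of the submodule lattice, as its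
  deviation for ascending chains (\<open>ndim_le_iff_deviation_le\<close>). In a modular lattice the intervals
  \<open>[X \<inter> Y, Y]\<close> and \<open>[X, X + Y]\<close> have the same deviation, and deviation at most \<open>\<alpha>\<close> passes from
  \<open>[A, B]\<close> and \<open>[B, C]\<close> to \<open>[A, C]\<close> (\<open>deviation_le_trans\<close>). A bound on \<open>[0, A]\<close> and \<open>[0, B]\<close>
  hence bounds \<open>[0, A + B]\<close>, through the subinterval \<open>[A \<inter> B, B]\<close> of \<open>[0, B]\<close>
  (\<open>deviation_le_join\<close>). Working with intervals of one fixed lattice avoids the changing quotient
  modules of the definition of the dimension, and the isomorphism theorems become the modular law.\<close>

section \<open>Deviation of intervals in a modular lattice of sets\<close>

text \<open>The counterpart of the Noetherian dimension for intervals of a family of sets: a factor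
  \<open>C (i + 1) / C i\<close> is replaced by the interval from \<open>C i\<close> to \<open>C (i + 1)\<close>. The recursion defines
  the bound "at most \<open>\<alpha>\<close>" and not the exact value, as the bound is what passes through
  constructions. The least ordinal stands for \<open>-1\<close>.\<close>

function deviation_le :: "'a set set \<Rightarrow> 'a set \<Rightarrow> 'a set \<Rightarrow> 'o::wellorder \<Rightarrow> bool" where
  "deviation_le L A B \<alpha> \<longleftrightarrow>
    (if \<forall>\<gamma>. \<alpha> \<le> \<gamma> then A = B
     else \<forall>C :: nat \<Rightarrow> 'a set.
       (\<forall>i. C i \<in> L \<and> A \<subseteq> C i \<and> C i \<subseteq> B \<and> C i \<subseteq> C (Suc i)) \<longrightarrow>
       (\<exists>k. \<forall>i\<ge>k. \<exists>\<beta>\<in>{..<\<alpha>}. deviation_le L (C i) (C (Suc i)) \<beta>))"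
  by pat_completeness auto
termination
  by (relation "inv_image {(\<beta>, \<alpha>). \<beta> < \<alpha>} (\<lambda>(L, A, B, \<alpha>). \<alpha>)") (auto intro: wf wf_inv_image)

declare deviation_le.simps [simp del]

lemma deviation_le_bot:
  "\<forall>\<gamma>. \<alpha> \<le> \<gamma> \<Longrightarrow> deviation_le L A B \<alpha> \<longleftrightarrow> A = B"
  by (subst deviation_le.simps) simp

lemma deviation_le_chains:
  "\<not> (\<forall>\<gamma>. \<alpha> \<le> \<gamma>) \<Longrightarrow> deviation_le L A B \<alpha> \<longleftrightarrow>
    (\<forall>C :: nat \<Rightarrow> 'a set.
       (\<forall>i. C i \<in> L \<and> A \<subseteq> C i \<and> C i \<subseteq> B \<and> C i \<subseteq> C (Suc i)) \<longrightarrow>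
       (\<exists>k. \<forall>i\<ge>k. \<exists>\<beta><\<alpha>. deviation_le L (C i) (C (Suc i)) \<beta>))"
  by (subst deviation_le.simps) (simp only: if_False Bex_def lessThan_iff)

lemma deviation_leI:
  assumes "\<not> (\<forall>\<gamma>. \<alpha> \<le> \<gamma>)"
    and "\<And>C :: nat \<Rightarrow> 'a set. \<lbrakk>\<And>i. C i \<in> L; \<And>i. A \<subseteq> C i; \<And>i. C i \<subseteq> B; \<And>i. C i \<subseteq> C (Suc i)\<rbrakk> \<Longrightarrow>
      \<exists>k. \<forall>i\<ge>k. \<exists>\<beta><\<alpha>. deviation_le L (C i) (C (Suc i)) \<beta>"
  shows "deviation_le L A B \<alpha>"
  unfolding deviation_le_chains[OF assms(1)] using assms(2) by blast

lemma deviation_leD: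
  assumes "deviation_le L A B \<alpha>" and "\<not> (\<forall>\<gamma>. \<alpha> \<le> \<gamma>)"
    and "\<And>i. C i \<in> L" "\<And>i. A \<subseteq> C i" "\<And>i. C i \<subseteq> B" "\<And>i. C i \<subseteq> C (Suc i)"
  shows "\<exists>k. \<forall>i\<ge>k. \<exists>\<beta><\<alpha>. deviation_le L (C i) (C (Suc i)) \<beta>"
  using assms(1) assms(3-6) unfolding deviation_le_chains[OF assms(2)] by simp

lemma bot_exists: "\<exists>\<beta>::'o::wellorder. \<forall>\<gamma>. \<beta> \<le> \<gamma>"
  by (rule exI[of _ "LEAST x. True"]) (simp add: Least_le)

lemma not_bot_obtain:
  fixes \<alpha> :: "'o::wellorder"
  assumes "\<not> (\<forall>\<gamma>. \<alpha> \<le> \<gamma>)"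
  obtains \<beta> where "\<beta> < \<alpha>" "\<forall>\<gamma>. \<beta> \<le> \<gamma>"
  using bot_exists assms by (metis order_le_less)

lemma deviation_le_refl: "deviation_le L A A \<alpha>"
proof (cases "\<forall>\<gamma>. \<alpha> \<le> \<gamma>")
  case True
  then show ?thesis by (simp add: deviation_le_bot)
next
  case False
  then obtain \<beta> where \<beta>: "\<beta> < \<alpha>" "\<forall>\<gamma>. \<beta> \<le> \<gamma>" by (rule not_bot_obtain)
  show ?thesis
  proof (rule deviation_leI[OF False])
    fix C :: "nat \<Rightarrow> 'a set"
    assume C: "\<And>i. A \<subseteq> C i" "\<And>i. C i \<subseteq> A"
    have "deviation_le L (C i) (C (Suc i)) \<beta>" for i
      using C[of i] C[of "Suc i"] \<beta>(2) by (simp add: deviation_le_bot)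
    then show "\<exists>k. \<forall>i\<ge>k. \<exists>\<beta><\<alpha>. deviation_le L (C i) (C (Suc i)) \<beta>"
      using \<beta>(1) by blast
  qed
qed

lemma deviation_le_mono:
  assumes "deviation_le L A B \<alpha>" and "\<alpha> \<le> \<alpha>'"
  shows "deviation_le L A B \<alpha>'"
proof (cases "\<forall>\<gamma>. \<alpha> \<le> \<gamma>")
  case True
  with assms(1) show ?thesis by (simp add: deviation_le_bot deviation_le_refl)
next
  case False
  then have not_bot: "\<not> (\<forall>\<gamma>. \<alpha>' \<le> \<gamma>)" using assms(2) order_trans by blast
  show ?thesis
    using assms(1) unfolding deviation_le_chains[OF False] deviation_le_chains[OF not_bot]
    by (meson assms(2) order_less_le_trans)
qed

lemma deviation_le_subinterval:
  assumes "deviation_le L A B \<alpha>" and "A \<subseteq> A'" "A' \<subseteq> B'" "B' \<subseteq> B"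
  shows "deviation_le L A' B' \<alpha>"
proof (cases "\<forall>\<gamma>. \<alpha> \<le> \<gamma>")
  case True
  with assms show ?thesis by (simp add: deviation_le_bot)
next
  case False
  show ?thesis
  proof (rule deviation_leI[OF False])
    fix C :: "nat \<Rightarrow> 'a set"
    assume C: "\<And>i. C i \<in> L" "\<And>i. A' \<subseteq> C i" "\<And>i. C i \<subseteq> B'" "\<And>i. C i \<subseteq> C (Suc i)"
    have C': "\<And>i. A \<subseteq> C i" "\<And>i. C i \<subseteq> B" using C(2,3) assms(2,4) by blast+
    show "\<exists>k. \<forall>i\<ge>k. \<exists>\<beta><\<alpha>. deviation_le L (C i) (C (Suc i)) \<beta>"
      by (rule deviation_leD[OF assms(1) False]) (simp_all add: C C')
  qed
qed

text \<open>The part of the structure of a submodule lattice that the dimension theory uses. Meets are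
  intersections, so only joins need a parameter.\<close>

locale modular_family =
  fixes L :: "'a set set" and join :: "'a set \<Rightarrow> 'a set \<Rightarrow> 'a set" (infixl "\<uplus>" 65)
  assumes inter_closed: "\<lbrakk>A \<in> L; B \<in> L\<rbrakk> \<Longrightarrow> A \<inter> B \<in> L"
    and join_closed: "\<lbrakk>A \<in> L; B \<in> L\<rbrakk> \<Longrightarrow> A \<uplus> B \<in> L"
    and join_upper1: "\<lbrakk>A \<in> L; B \<in> L\<rbrakk> \<Longrightarrow> A \<subseteq> A \<uplus> B"
    and join_upper2: "\<lbrakk>A \<in> L; B \<in> L\<rbrakk> \<Longrightarrow> B \<subseteq> A \<uplus> B"
    and join_least: "\<lbrakk>A \<in> L; B \<in> L; C \<in> L; A \<subseteq> C; B \<subseteq> C\<rbrakk> \<Longrightarrow> A \<uplus> B \<subseteq> C"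
    and modular: "\<lbrakk>A \<in> L; B \<in> L; C \<in> L; A \<subseteq> C\<rbrakk> \<Longrightarrow> (A \<uplus> B) \<inter> C \<subseteq> A \<uplus> (B \<inter> C)"
begin

lemma modular_eq: "\<lbrakk>A \<in> L; B \<in> L; C \<in> L; A \<subseteq> C\<rbrakk> \<Longrightarrow> (A \<uplus> B) \<inter> C = A \<uplus> (B \<inter> C)"
  using modular[of A B C] join_upper1[of A B] join_upper2[of A B] join_closed[of A B]
    join_least[of A "B \<inter> C" "(A \<uplus> B) \<inter> C"] inter_closed[of B C] inter_closed[of "A \<uplus> B" C]
  by blast

lemma join_mono: "\<lbrakk>A \<in> L; B \<in> L; C \<in> L; B \<subseteq> C\<rbrakk> \<Longrightarrow> A \<uplus> B \<subseteq> A \<uplus> C"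
  using join_least[of A B "A \<uplus> C"] join_upper1[of A C] join_upper2[of A C] join_closed[of A C]
  by blast

text \<open>A chain in \<open>[X, X + Y]\<close> is recovered by \<open>C i = X + (Y \<inter> C i)\<close> from its trace on \<open>Y\<close>, and
  each step of the chain is itself the upward transpose of the corresponding step of the trace; so
  the induction hypothesis applies to the steps.\<close>

lemma deviation_le_transpose_up:
  assumes "X \<in> L" "Y \<in> L" and "deviation_le L (X \<inter> Y) Y \<alpha>"
  shows "deviation_le L X (X \<uplus> Y) \<alpha>"
  using assms
proof (induction \<alpha> arbitrary: X Y rule: less_induct)
  case (less \<alpha>)
  note XY = less.prems(1,2)
  show ?case
  proof (cases "\<forall>\<gamma>. \<alpha> \<le> \<gamma>")
    case True
    then have "X \<inter> Y = Y" using less.prems(3) by (simp add: deviation_le_bot)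
    then have "X \<uplus> Y = X" using join_least[of X Y X] join_upper1[of X Y] XY by blast
    then show ?thesis by (simp add: deviation_le_refl)
  next
    case False
    show ?thesis
    proof (rule deviation_leI[OF False])
      fix C :: "nat \<Rightarrow> 'a set"
      assume C: "\<And>i. C i \<in> L" "\<And>i. X \<subseteq> C i" "\<And>i. C i \<subseteq> X \<uplus> Y" "\<And>i. C i \<subseteq> C (Suc i)"
      have CY: "C i = X \<uplus> (Y \<inter> C i)" for i
        using modular_eq[OF XY C(1,2)] C(3)[of i] by blast
      have "\<exists>k. \<forall>i\<ge>k. \<exists>\<beta><\<alpha>. deviation_le L (Y \<inter> C i) (Y \<inter> C (Suc i)) \<beta>"
      proof (rule deviation_leD[OF less.prems(3) False])
        show "Y \<inter> C i \<in> L" "X \<inter> Y \<subseteq> Y \<inter> C i" "Y \<inter> C i \<subseteq> Y" "Y \<inter> C i \<subseteq> Y \<inter> C (Suc i)" for i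
          using inter_closed[OF XY(2) C(1)] C(2,4)[of i] by blast+
      qed
      then obtain k where k: "\<forall>i\<ge>k. \<exists>\<beta><\<alpha>. deviation_le L (Y \<inter> C i) (Y \<inter> C (Suc i)) \<beta>" ..
      have "\<exists>\<beta><\<alpha>. deviation_le L (C i) (C (Suc i)) \<beta>" if i: "i \<ge> k" for i
      proof -
        obtain \<beta> where \<beta>: "\<beta> < \<alpha>" "deviation_le L (Y \<inter> C i) (Y \<inter> C (Suc i)) \<beta>"
          using k i by blast
        have Y': "Y \<inter> C (Suc i) \<in> L" using C XY inter_closed by blast
        have meet: "C i \<inter> (Y \<inter> C (Suc i)) = Y \<inter> C i" using C(4)[of i] by blast
        have join: "C i \<uplus> (Y \<inter> C (Suc i)) = C (Suc i)"
        proof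
          show "C i \<uplus> (Y \<inter> C (Suc i)) \<subseteq> C (Suc i)" using join_least C Y' by blast
          have "X \<uplus> (Y \<inter> C (Suc i)) \<subseteq> C i \<uplus> (Y \<inter> C (Suc i))"
            using join_least[OF XY(1) Y' join_closed[OF C(1)[of i] Y']]
              join_upper1[OF C(1)[of i] Y'] join_upper2[OF C(1)[of i] Y'] C(2)[of i] by blast
          then show "C (Suc i) \<subseteq> C i \<uplus> (Y \<inter> C (Suc i))" using CY[of "Suc i"] by simp
        qed
        show ?thesis
          using less.IH[OF \<beta>(1) C(1)[of i] Y'] \<beta> unfolding meet join by blast
      qed
      then show "\<exists>k. \<forall>i\<ge>k. \<exists>\<beta><\<alpha>. deviation_le L (C i) (C (Suc i)) \<beta>" by blast
    qed
  qed
qed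

text \<open>The mirror image of the preceding argument: a chain in \<open>[X \<inter> Y, Y]\<close> is recovered by
  \<open>C i = (X + C i) \<inter> Y\<close> from its translate by \<open>X\<close>.\<close>

lemma deviation_le_transpose_down:
  assumes "X \<in> L" "Y \<in> L" and "deviation_le L X (X \<uplus> Y) \<alpha>"
  shows "deviation_le L (X \<inter> Y) Y \<alpha>"
  using assms
proof (induction \<alpha> arbitrary: X Y rule: less_induct)
  case (less \<alpha>)
  note XY = less.prems(1,2)
  show ?case
  proof (cases "\<forall>\<gamma>. \<alpha> \<le> \<gamma>")
    case True
    then have "X \<uplus> Y = X" using less.prems(3) by (simp add: deviation_le_bot)
    then have "X \<inter> Y = Y" using join_upper2[of X Y] XY by blast
    then show ?thesis by (simp add: deviation_le_refl)
  next
    case False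
    show ?thesis
    proof (rule deviation_leI[OF False])
      fix C :: "nat \<Rightarrow> 'a set"
      assume C: "\<And>i. C i \<in> L" "\<And>i. X \<inter> Y \<subseteq> C i" "\<And>i. C i \<subseteq> Y" "\<And>i. C i \<subseteq> C (Suc i)"
      have "\<exists>k. \<forall>i\<ge>k. \<exists>\<beta><\<alpha>. deviation_le L (X \<uplus> C i) (X \<uplus> C (Suc i)) \<beta>"
        by (rule deviation_leD[OF less.prems(3) False])
          (intro join_closed join_upper1 join_mono XY C)+
      then obtain k where k: "\<forall>i\<ge>k. \<exists>\<beta><\<alpha>. deviation_le L (X \<uplus> C i) (X \<uplus> C (Suc i)) \<beta>" ..
      have "\<exists>\<beta><\<alpha>. deviation_le L (C i) (C (Suc i)) \<beta>" if i: "i \<ge> k" for i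
      proof -
        obtain \<beta> where \<beta>: "\<beta> < \<alpha>" "deviation_le L (X \<uplus> C i) (X \<uplus> C (Suc i)) \<beta>"
          using k i by blast
        have J: "X \<uplus> C i \<in> L" using XY C join_closed by blast
        have join: "X \<uplus> C i \<uplus> C (Suc i) = X \<uplus> C (Suc i)"
        proof
          show "X \<uplus> C i \<uplus> C (Suc i) \<subseteq> X \<uplus> C (Suc i)"
            using join_least[OF J C(1)[of "Suc i"] join_closed[OF XY(1) C(1)[of "Suc i"]]]
              join_mono[OF XY(1) C(1)[of i] C(1)[of "Suc i"] C(4)]
              join_upper2[OF XY(1) C(1)[of "Suc i"]] by blast
          show "X \<uplus> C (Suc i) \<subseteq> X \<uplus> C i \<uplus> C (Suc i)"
            using join_least[OF XY(1) C(1)[of "Suc i"] join_closed[OF J C(1)[of "Suc i"]]]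
              join_upper1[OF XY(1) C(1)[of i]] join_upper1[OF J C(1)[of "Suc i"]]
              join_upper2[OF J C(1)[of "Suc i"]] by blast
        qed
        have "(C i \<uplus> X) \<inter> Y = C i \<uplus> (X \<inter> Y)" using modular_eq XY C by blast
        also have "\<dots> = C i"
          using join_least[OF C(1)[of i] inter_closed[OF XY] C(1)[of i]] C(2)[of i]
            join_upper1[OF C(1)[of i] inter_closed[OF XY]] by blast
        finally have "(X \<uplus> C i) \<inter> Y = C i"
          using join_least[OF XY(1) C(1)[of i] join_closed[OF C(1)[of i] XY(1)]]
            join_upper1[OF C(1)[of i] XY(1)] join_upper2[OF C(1)[of i] XY(1)]
            join_upper2[OF XY(1) C(1)[of i]] C(3)[of i] by blast
        then have meet: "(X \<uplus> C i) \<inter> C (Suc i) = C i"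
          using C(3)[of "Suc i"] C(4)[of i] join_upper2[OF XY(1) C(1)[of i]] by blast
        show ?thesis
          using less.IH[OF \<beta>(1) J C(1)[of "Suc i"]] \<beta> unfolding meet join by blast
      qed
      then show "\<exists>k. \<forall>i\<ge>k. \<exists>\<beta><\<alpha>. deviation_le L (C i) (C (Suc i)) \<beta>" by blast
    qed
  qed
qed

text \<open>A chain \<open>D i\<close> in \<open>[A, C]\<close> leaves the traces \<open>D i \<inter> B\<close> and \<open>B + D i\<close> in the two halves.
  The step from \<open>D i\<close> to \<open>D (i + 1)\<close> is cut at \<open>E = (B + D i) \<inter> D (i + 1)\<close>, which by modularity
  equals \<open>D i + (D (i + 1) \<inter> B)\<close>; the lower part is then a transpose of a step of the first trace
  and the upper part a transpose of a step of the second. Once both steps have deviation below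
  \<open>\<alpha>\<close>, the induction hypothesis joins the two parts at the larger of their bounds.\<close>

lemma deviation_le_trans:
  assumes "A \<in> L" "B \<in> L" "C \<in> L" "A \<subseteq> B" "B \<subseteq> C"
    and "deviation_le L A B \<alpha>" "deviation_le L B C \<alpha>"
  shows "deviation_le L A C \<alpha>"
  using assms
proof (induction \<alpha> arbitrary: A B C rule: less_induct)
  case (less \<alpha>)
  show ?case
  proof (cases "\<forall>\<gamma>. \<alpha> \<le> \<gamma>")
    case True
    with less.prems(6,7) show ?thesis by (simp add: deviation_le_bot)
  next
    case False
    note B = less.prems(2)
    show ?thesis
    proof (rule deviation_leI[OF False])
      fix D :: "nat \<Rightarrow> 'a set"
      assume D: "\<And>i. D i \<in> L" "\<And>i. A \<subseteq> D i" "\<And>i. D i \<subseteq> C" "\<And>i. D i \<subseteq> D (Suc i)"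
      have "\<exists>k. \<forall>i\<ge>k. \<exists>\<beta><\<alpha>. deviation_le L (D i \<inter> B) (D (Suc i) \<inter> B) \<beta>"
      proof (rule deviation_leD[OF less.prems(6) False])
        show "D i \<inter> B \<in> L" "A \<subseteq> D i \<inter> B" "D i \<inter> B \<subseteq> B" "D i \<inter> B \<subseteq> D (Suc i) \<inter> B" for i
          using inter_closed[OF D(1) B] D(2,4)[of i] less.prems(4) by blast+
      qed
      then obtain k1 where k1: "\<forall>i\<ge>k1. \<exists>\<beta><\<alpha>. deviation_le L (D i \<inter> B) (D (Suc i) \<inter> B) \<beta>" ..
      have "\<exists>k. \<forall>i\<ge>k. \<exists>\<beta><\<alpha>. deviation_le L (B \<uplus> D i) (B \<uplus> D (Suc i)) \<beta>"
        by (rule deviation_leD[OF less.prems(7) False])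
          (intro join_closed join_upper1 join_mono join_least B D less.prems(3,5))+
      then obtain k2 where k2: "\<forall>i\<ge>k2. \<exists>\<beta><\<alpha>. deviation_le L (B \<uplus> D i) (B \<uplus> D (Suc i)) \<beta>" ..
      have "\<exists>\<beta><\<alpha>. deviation_le L (D i) (D (Suc i)) \<beta>" if i: "i \<ge> max k1 k2" for i
      proof -
        obtain \<beta>1 \<beta>2 where \<beta>: "\<beta>1 < \<alpha>" "deviation_le L (D i \<inter> B) (D (Suc i) \<inter> B) \<beta>1"
            "\<beta>2 < \<alpha>" "deviation_le L (B \<uplus> D i) (B \<uplus> D (Suc i)) \<beta>2"
          using k1[rule_format, of i] k2[rule_format, of i] i by auto
        define \<beta> where "\<beta> = max \<beta>1 \<beta>2"
        have less: "\<beta> < \<alpha>" using \<beta> by (simp add: \<beta>_def)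
        note D0 = D(1)[of i] and D1 = D(1)[of "Suc i"] and D01 = D(4)[of i]
        have J: "B \<uplus> D i \<in> L" and I: "D (Suc i) \<inter> B \<in> L"
          using join_closed inter_closed B D0 D1 by blast+
        define E where "E = D i \<uplus> (D (Suc i) \<inter> B)"
        have EL: "E \<in> L" unfolding E_def by (rule join_closed[OF D0 I])
        have E_eq: "E = (B \<uplus> D i) \<inter> D (Suc i)"
        proof -
          have "B \<uplus> D i = D i \<uplus> B"
            by (intro equalityI join_least join_upper1 join_upper2 join_closed B D0)
          then show ?thesis
            using modular_eq[OF D0 B D1 D01] by (simp add: E_def Int_commute)
        qed
        have "D i \<inter> (D (Suc i) \<inter> B) = D i \<inter> B" using D01 by blast
        then have low: "deviation_le L (D i) E \<beta>"
          using deviation_le_transpose_up[OF D0 I, of \<beta>] deviation_le_mono[OF \<beta>(2), of \<beta>]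
          by (simp add: E_def \<beta>_def)
        have "B \<uplus> D i \<uplus> D (Suc i) = B \<uplus> D (Suc i)"
        proof
          show "B \<uplus> D i \<uplus> D (Suc i) \<subseteq> B \<uplus> D (Suc i)"
            using join_least[OF J D1 join_closed[OF B D1]] join_mono[OF B D0 D1 D01]
              join_upper2[OF B D1] by blast
          show "B \<uplus> D (Suc i) \<subseteq> B \<uplus> D i \<uplus> D (Suc i)"
            using join_least[OF B D1 join_closed[OF J D1]] join_upper1[OF B D0]
              join_upper1[OF J D1] join_upper2[OF J D1] by blast
        qed
        then have high: "deviation_le L E (D (Suc i)) \<beta>"
          using deviation_le_transpose_down[OF J D1, of \<beta>] deviation_le_mono[OF \<beta>(4), of \<beta>]
          by (simp add: E_eq \<beta>_def)
        have "D i \<subseteq> E" "E \<subseteq> D (Suc i)"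
          using join_upper1[OF D0 I] E_eq by (auto simp: E_def)
        then show ?thesis
          using less.IH[OF less D0 EL D1 _ _ low high] less by blast
      qed
      then show "\<exists>k. \<forall>i\<ge>k. \<exists>\<beta><\<alpha>. deviation_le L (D i) (D (Suc i)) \<beta>" by blast
    qed
  qed
qed

lemma deviation_le_join:
  assumes "Z \<in> L" "A \<in> L" "B \<in> L" "Z \<subseteq> A" "Z \<subseteq> B"
    and "deviation_le L Z A \<alpha>" "deviation_le L Z B \<alpha>"
  shows "deviation_le L Z (A \<uplus> B) \<alpha>"
proof (rule deviation_le_trans[of Z A])
  show "deviation_le L A (A \<uplus> B) \<alpha>"
    by (rule deviation_le_transpose_up[OF assms(2,3)])
      (rule deviation_le_subinterval[OF assms(7)], use assms in auto)
qed (use assms join_closed join_upper1 in blast)+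

end

section \<open>The lattice of submodules\<close>

context right_module
begin

lemma smult_zero: "a \<in> carrier R \<Longrightarrow> a \<odot>\<^bsub>M\<^esub> \<zero>\<^bsub>M\<^esub> = \<zero>\<^bsub>M\<^esub>"
  using smult_r_distr[of a "\<zero>\<^bsub>M\<^esub>" "\<zero>\<^bsub>M\<^esub>"] smult_closed[of a "\<zero>\<^bsub>M\<^esub>"]
  by (metis M.add.l_cancel_one M.zero_closed M.l_zero)

lemma zero_smult: "x \<in> carrier M \<Longrightarrow> \<zero>\<^bsub>R\<^esub> \<odot>\<^bsub>M\<^esub> x = \<zero>\<^bsub>M\<^esub>"
  using smult_l_distr[of "\<zero>\<^bsub>R\<^esub>" "\<zero>\<^bsub>R\<^esub>" x] smult_closed[of "\<zero>\<^bsub>R\<^esub>" x]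
  by (metis M.add.l_cancel_one R.zero_closed R.l_zero)

lemma uminus_one_smult:
  assumes "x \<in> carrier M"
  shows "(\<ominus>\<^bsub>R\<^esub> \<one>\<^bsub>R\<^esub>) \<odot>\<^bsub>M\<^esub> x = \<ominus>\<^bsub>M\<^esub> x"
proof -
  have "(\<ominus>\<^bsub>R\<^esub> \<one>\<^bsub>R\<^esub>) \<odot>\<^bsub>M\<^esub> x \<oplus>\<^bsub>M\<^esub> x = \<zero>\<^bsub>M\<^esub>"
    using smult_l_distr[of "\<ominus>\<^bsub>R\<^esub> \<one>\<^bsub>R\<^esub>" "\<one>\<^bsub>R\<^esub>" x] assms
    by (simp add: smult_one R.l_neg zero_smult)
  then show ?thesis using assms by (intro M.minus_equality[symmetric] smult_closed) auto
qed

text \<open>Closure under negatives is automatic, as \<open>-x\<close> is the multiple of \<open>x\<close> by \<open>-1\<close>.\<close>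

lemma submodule_iff:
  "submodule H R M \<longleftrightarrow> H \<subseteq> carrier M \<and> \<zero>\<^bsub>M\<^esub> \<in> H \<and>
    (\<forall>x\<in>H. \<forall>y\<in>H. x \<oplus>\<^bsub>M\<^esub> y \<in> H) \<and> (\<forall>a\<in>carrier R. \<forall>x\<in>H. a \<odot>\<^bsub>M\<^esub> x \<in> H)"
  (is "_ \<longleftrightarrow> ?P")
proof
  assume "submodule H R M"
  then interpret submodule H R M .
  show ?P using subset one_closed m_closed smult_closed by auto
next
  assume P: ?P
  have "\<ominus>\<^bsub>M\<^esub> x \<in> H" if "x \<in> H" for x
    using P that uminus_one_smult[of x] by (metis R.a_inv_closed R.one_closed subsetD)
  then show "submodule H R M"
    using P by unfold_locales (auto simp: a_inv_def)
qed

lemma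
  assumes "submodule H R M"
  shows submodule_subset: "H \<subseteq> carrier M"
    and submodule_zero: "\<zero>\<^bsub>M\<^esub> \<in> H"
    and submodule_add: "\<lbrakk>x \<in> H; y \<in> H\<rbrakk> \<Longrightarrow> x \<oplus>\<^bsub>M\<^esub> y \<in> H"
    and submodule_smult: "\<lbrakk>a \<in> carrier R; x \<in> H\<rbrakk> \<Longrightarrow> a \<odot>\<^bsub>M\<^esub> x \<in> H"
  using assms unfolding submodule_iff by blast+

lemma submodule_uminus:
  assumes "submodule H R M" "x \<in> H"
  shows "\<ominus>\<^bsub>M\<^esub> x \<in> H"
  using submodule_smult[OF assms(1), of "\<ominus>\<^bsub>R\<^esub> \<one>\<^bsub>R\<^esub>" x] uminus_one_smult[of x]
    submodule_subset[OF assms(1)] assms(2) by auto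

lemma submodule_carrier: "submodule (carrier M) R M"
  unfolding submodule_iff by (auto simp: smult_closed)

lemma submodule_0: "submodule {\<zero>\<^bsub>M\<^esub>} R M"
  unfolding submodule_iff by (auto simp: smult_zero)

lemma submodule_add_cancel:
  assumes "submodule H R M" "x \<in> H" "y \<in> carrier M" "x \<oplus>\<^bsub>M\<^esub> y \<in> H"
  shows "y \<in> H"
proof -
  have x: "x \<in> carrier M" using submodule_subset assms(1,2) by blast
  have "y = \<ominus>\<^bsub>M\<^esub> x \<oplus>\<^bsub>M\<^esub> (x \<oplus>\<^bsub>M\<^esub> y)"
    using x assms(3) by (simp add: M.r_neg1)
  also have "\<dots> \<in> H" using submodule_add submodule_uminus assms by blast
  finally show ?thesis .
qed

lemma set_add_iff: "z \<in> A <+>\<^bsub>M\<^esub> B \<longleftrightarrow> (\<exists>x\<in>A. \<exists>y\<in>B. z = x \<oplus>\<^bsub>M\<^esub> y)"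
  unfolding set_add_def' by blast

lemma submodule_set_add:
  assumes "submodule A R M" "submodule B R M"
  shows "submodule (A <+>\<^bsub>M\<^esub> B) R M"
  unfolding submodule_iff
proof (intro conjI ballI subsetI)
  have A: "A \<subseteq> carrier M" and B: "B \<subseteq> carrier M" using assms submodule_subset by blast+
  fix z assume "z \<in> A <+>\<^bsub>M\<^esub> B"
  then obtain x y where z: "x \<in> A" "y \<in> B" "z = x \<oplus>\<^bsub>M\<^esub> y" unfolding set_add_iff by blast
  then show "z \<in> carrier M" using A B by blast
  {
    fix z' assume "z' \<in> A <+>\<^bsub>M\<^esub> B"
    then obtain x' y' where z': "x' \<in> A" "y' \<in> B" "z' = x' \<oplus>\<^bsub>M\<^esub> y'"
      unfolding set_add_iff by blast
    have "z \<oplus>\<^bsub>M\<^esub> z' = (x \<oplus>\<^bsub>M\<^esub> x') \<oplus>\<^bsub>M\<^esub> (y \<oplus>\<^bsub>M\<^esub> y')"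
      using z z' A B M.a_ac(1,2,3) by (simp add: subset_eq)
    then show "z \<oplus>\<^bsub>M\<^esub> z' \<in> A <+>\<^bsub>M\<^esub> B"
      unfolding set_add_iff using z z' assms submodule_add by blast
  }
  fix a assume a: "a \<in> carrier R"
  have "a \<odot>\<^bsub>M\<^esub> z = a \<odot>\<^bsub>M\<^esub> x \<oplus>\<^bsub>M\<^esub> a \<odot>\<^bsub>M\<^esub> y"
    using z A B a by (auto intro: smult_r_distr)
  then show "a \<odot>\<^bsub>M\<^esub> z \<in> A <+>\<^bsub>M\<^esub> B"
    unfolding set_add_iff using z a assms submodule_smult by blast
next
  have "\<zero>\<^bsub>M\<^esub> = \<zero>\<^bsub>M\<^esub> \<oplus>\<^bsub>M\<^esub> \<zero>\<^bsub>M\<^esub>" by simp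
  then show "\<zero>\<^bsub>M\<^esub> \<in> A <+>\<^bsub>M\<^esub> B"
    unfolding set_add_iff using assms submodule_zero by blast
qed

text \<open>Dedekind's modular law: if \<open>x + y\<close> and \<open>x\<close> lie in \<open>C\<close>, so does \<open>y\<close>.\<close>

lemma modular_family_submodules:
  "modular_family {H. submodule H R M} (\<lambda>A B. A <+>\<^bsub>M\<^esub> B)"
proof
  fix A B assume "A \<in> {H. submodule H R M}" "B \<in> {H. submodule H R M}"
  then have AB: "submodule A R M" "submodule B R M" by auto
  then have sub: "A \<subseteq> carrier M" "B \<subseteq> carrier M" using submodule_subset by blast+
  show "A \<inter> B \<in> {H. submodule H R M}" using AB unfolding submodule_iff by auto
  show "A <+>\<^bsub>M\<^esub> B \<in> {H. submodule H R M}" using AB submodule_set_add by simp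
  show "A \<subseteq> A <+>\<^bsub>M\<^esub> B"
  proof
    fix x assume "x \<in> A"
    moreover from this have "x = x \<oplus>\<^bsub>M\<^esub> \<zero>\<^bsub>M\<^esub>" using sub by (simp add: subset_eq)
    ultimately show "x \<in> A <+>\<^bsub>M\<^esub> B"
      unfolding set_add_iff using AB submodule_zero by blast
  qed
  show "B \<subseteq> A <+>\<^bsub>M\<^esub> B"
  proof
    fix x assume "x \<in> B"
    moreover from this have "x = \<zero>\<^bsub>M\<^esub> \<oplus>\<^bsub>M\<^esub> x" using sub by (simp add: subset_eq)
    ultimately show "x \<in> A <+>\<^bsub>M\<^esub> B"
      unfolding set_add_iff using AB submodule_zero by blast
  qed
  fix C assume "C \<in> {H. submodule H R M}"
  then have C: "submodule C R M" by auto
  {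
    assume "A \<subseteq> C" "B \<subseteq> C"
    then show "A <+>\<^bsub>M\<^esub> B \<subseteq> C"
      using submodule_add[OF C] by (auto simp: set_add_def')
  next
    assume AC: "A \<subseteq> C"
    show "(A <+>\<^bsub>M\<^esub> B) \<inter> C \<subseteq> A <+>\<^bsub>M\<^esub> (B \<inter> C)"
    proof
      fix z assume "z \<in> (A <+>\<^bsub>M\<^esub> B) \<inter> C"
      then obtain x y where z: "x \<in> A" "y \<in> B" "z = x \<oplus>\<^bsub>M\<^esub> y" "z \<in> C"
        unfolding set_add_def' by blast
      then have "y \<in> C" using submodule_add_cancel[OF C, of x y] AC sub(2) by auto
      then show "z \<in> A <+>\<^bsub>M\<^esub> (B \<inter> C)" unfolding set_add_def' using z by blast
    qed
  }
qed

lemma right_module_submodule: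
  assumes "submodule H R M"
  shows "right_module R (M\<lparr>carrier := H\<rparr>)"
proof -
  have H: "x \<in> carrier M" if "x \<in> H" for x using submodule_subset[OF assms] that by blast
  have "abelian_group (M\<lparr>carrier := H\<rparr>)"
  proof (rule abelian_groupI)
    fix x assume "x \<in> carrier (M\<lparr>carrier := H\<rparr>)"
    then have "x \<in> H" by simp
    then show "\<exists>y\<in>carrier (M\<lparr>carrier := H\<rparr>). y \<oplus>\<^bsub>M\<lparr>carrier := H\<rparr>\<^esub> x = \<zero>\<^bsub>M\<lparr>carrier := H\<rparr>\<^esub>"
      using submodule_uminus[OF assms] H by (auto simp: M.l_neg intro!: bexI[of _ "\<ominus>\<^bsub>M\<^esub> x"])
  qed (use submodule_add[OF assms] submodule_zero[OF assms] H M.a_assoc M.a_comm in auto)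
  then show ?thesis
    by (intro right_module.intro right_module_axioms.intro R.ring_axioms)
      (use submodule_smult[OF assms] H in
        \<open>auto simp: smult_l_distr smult_r_distr smult_assoc smult_one\<close>)
qed

end

section \<open>Quotients presented by surjections\<close>

text \<open>A surjective homomorphism from \<open>C\<close> onto \<open>Q\<close> with kernel \<open>A\<close>. Such a map presents \<open>Q\<close> as
  \<open>C / A\<close> without cosets, so that an iterated quotient is presented by a composition and the element
  type of \<open>Q\<close> is free.\<close>

definition quotient_map ::
  "('r, 's) ring_scheme \<Rightarrow> ('r, 'm, 'e) module_scheme \<Rightarrow> 'm set \<Rightarrow> 'm set \<Rightarrow>
    ('r, 'n, 'f) module_scheme \<Rightarrow> ('m \<Rightarrow> 'n) \<Rightarrow> bool" where
  "quotient_map R M A C Q f \<longleftrightarrow>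
    f ` C = carrier Q \<and>
    (\<forall>x\<in>C. \<forall>y\<in>C. f (x \<oplus>\<^bsub>M\<^esub> y) = f x \<oplus>\<^bsub>Q\<^esub> f y) \<and>
    (\<forall>a\<in>carrier R. \<forall>x\<in>C. f (a \<odot>\<^bsub>M\<^esub> x) = a \<odot>\<^bsub>Q\<^esub> f x) \<and>
    {x \<in> C. f x = \<zero>\<^bsub>Q\<^esub>} = A"

locale module_quotient = M: right_module R M + Q: right_module R Q
  for R :: "('r, 's) ring_scheme" and M :: "('r, 'm, 'e) module_scheme"
    and Q :: "('r, 'n, 'f) module_scheme" +
  fixes A C f
  assumes submodules: "submodule A R M" "submodule C R M"
    and quotient: "quotient_map R M A C Q f"
begin

lemma image: "f ` C = carrier Q"
  and add: "\<lbrakk>x \<in> C; y \<in> C\<rbrakk> \<Longrightarrow> f (x \<oplus>\<^bsub>M\<^esub> y) = f x \<oplus>\<^bsub>Q\<^esub> f y"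
  and smult: "\<lbrakk>a \<in> carrier R; x \<in> C\<rbrakk> \<Longrightarrow> f (a \<odot>\<^bsub>M\<^esub> x) = a \<odot>\<^bsub>Q\<^esub> f x"
  and kernel: "A = {x \<in> C. f x = \<zero>\<^bsub>Q\<^esub>}"
  using quotient unfolding quotient_map_def by auto

lemma closed: "x \<in> C \<Longrightarrow> f x \<in> carrier Q"
  using image by blast

lemma zero: "f \<zero>\<^bsub>M\<^esub> = \<zero>\<^bsub>Q\<^esub>"
  using M.submodule_zero[OF submodules(1)] kernel by blast

lemma carrier: "x \<in> C \<Longrightarrow> x \<in> carrier M"
  using M.submodule_subset[OF submodules(2)] by blast

lemma uminus:
  assumes "x \<in> C"
  shows "f (\<ominus>\<^bsub>M\<^esub> x) = \<ominus>\<^bsub>Q\<^esub> f x"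
  using smult[of "\<ominus>\<^bsub>R\<^esub> \<one>\<^bsub>R\<^esub>" x] assms carrier[OF assms] closed[OF assms]
  by (simp add: M.uminus_one_smult Q.uminus_one_smult)

lemma eq_iff:
  assumes "x \<in> C" "y \<in> C"
  shows "f x = f y \<longleftrightarrow> x \<ominus>\<^bsub>M\<^esub> y \<in> A"
proof -
  have y: "\<ominus>\<^bsub>M\<^esub> y \<in> C" by (rule M.submodule_uminus[OF submodules(2) assms(2)])
  have "f (x \<ominus>\<^bsub>M\<^esub> y) = f x \<ominus>\<^bsub>Q\<^esub> f y"
    using assms y by (simp add: a_minus_def add uminus)
  moreover have "x \<ominus>\<^bsub>M\<^esub> y \<in> C"
    unfolding a_minus_def by (rule M.submodule_add[OF submodules(2) assms(1) y])
  moreover have "f x = f y \<longleftrightarrow> f x \<ominus>\<^bsub>Q\<^esub> f y = \<zero>\<^bsub>Q\<^esub>"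
    using closed[OF assms(1)] closed[OF assms(2)]
    by (metis a_minus_def Q.M.a_inv_closed Q.M.minus_equality Q.M.minus_minus Q.M.r_neg)
  ultimately show ?thesis using kernel by auto
qed

lemma submodule_image:
  assumes "submodule D R M" "D \<subseteq> C"
  shows "submodule (f ` D) R Q"
  unfolding Q.submodule_iff
proof (intro conjI ballI)
  show "f ` D \<subseteq> carrier Q" using assms(2) image by blast
  show "\<zero>\<^bsub>Q\<^esub> \<in> f ` D" using zero M.submodule_zero[OF assms(1)] by force
next
  fix u v assume "u \<in> f ` D" "v \<in> f ` D"
  then obtain x y where "x \<in> D" "y \<in> D" "u = f x" "v = f y" by blast
  moreover from this have "u \<oplus>\<^bsub>Q\<^esub> v = f (x \<oplus>\<^bsub>M\<^esub> y)" using add assms(2) by (simp add: subset_eq)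
  ultimately show "u \<oplus>\<^bsub>Q\<^esub> v \<in> f ` D" using M.submodule_add[OF assms(1)] by blast
next
  fix a u assume "a \<in> carrier R" "u \<in> f ` D"
  moreover from this obtain x where "x \<in> D" "u = f x" by blast
  moreover from calculation have "a \<odot>\<^bsub>Q\<^esub> u = f (a \<odot>\<^bsub>M\<^esub> x)" using smult assms(2) by auto
  ultimately show "a \<odot>\<^bsub>Q\<^esub> u \<in> f ` D" using M.submodule_smult[OF assms(1)] by blast
qed

lemma submodule_preimage:
  assumes "submodule P R Q"
  shows "submodule {x \<in> C. f x \<in> P} R M"
  unfolding M.submodule_iff
proof (intro conjI ballI subsetI)
  show "\<zero>\<^bsub>M\<^esub> \<in> {x \<in> C. f x \<in> P}"
    using M.submodule_zero[OF submodules(2)] Q.submodule_zero[OF assms] zero by simp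
next
  fix x y assume "x \<in> {x \<in> C. f x \<in> P}" "y \<in> {x \<in> C. f x \<in> P}"
  then show "x \<oplus>\<^bsub>M\<^esub> y \<in> {x \<in> C. f x \<in> P}"
    using M.submodule_add[OF submodules(2)] Q.submodule_add[OF assms] by (simp add: add)
next
  fix a x assume "a \<in> carrier R" "x \<in> {x \<in> C. f x \<in> P}"
  then show "a \<odot>\<^bsub>M\<^esub> x \<in> {x \<in> C. f x \<in> P}"
    using M.submodule_smult[OF submodules(2)] Q.submodule_smult[OF assms] by (simp add: smult)
qed (use carrier in blast)

lemma preimage_image:
  assumes "submodule D R M" "A \<subseteq> D" "D \<subseteq> C"
  shows "{x \<in> C. f x \<in> f ` D} = D"
proof
  show "{x \<in> C. f x \<in> f ` D} \<subseteq> D"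
  proof
    fix x assume "x \<in> {x \<in> C. f x \<in> f ` D}"
    then obtain y where x: "x \<in> C" and y: "y \<in> D" "f x = f y" by blast
    have "y \<in> carrier M" "y \<in> C" using y carrier assms(3) by blast+
    then have "x \<ominus>\<^bsub>M\<^esub> y \<in> D" "x = (x \<ominus>\<^bsub>M\<^esub> y) \<oplus>\<^bsub>M\<^esub> y"
      using eq_iff[OF x, of y] y assms(2) carrier[OF x]
      by (auto simp: a_minus_def M.M.a_assoc M.M.l_neg)
    then show "x \<in> D" using M.submodule_add[OF assms(1)] y(1) by metis
  qed
qed (use assms(3) in auto)

text \<open>The third isomorphism theorem: a subquotient of \<open>C / A\<close> is the subquotient of \<open>M\<close> formed by
  the preimages.\<close>

lemma quotient_map_comp:
  assumes "quotient_map R Q P1 P2 Q' g" "P2 \<subseteq> carrier Q"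
  shows "quotient_map R M {x \<in> C. f x \<in> P1} {x \<in> C. f x \<in> P2} Q' (g \<circ> f)"
proof -
  have "f ` {x \<in> C. f x \<in> P2} = P2"
  proof
    show "P2 \<subseteq> f ` {x \<in> C. f x \<in> P2}"
    proof
      fix q assume q: "q \<in> P2"
      then obtain x where "x \<in> C" "q = f x" using image assms(2) by blast
      then show "q \<in> f ` {x \<in> C. f x \<in> P2}" using q by simp
    qed
  qed auto
  then have "(g \<circ> f) ` {x \<in> C. f x \<in> P2} = carrier Q'"
    using assms(1) unfolding quotient_map_def image_comp[symmetric] by metis
  moreover have "g (f (x \<oplus>\<^bsub>M\<^esub> y)) = g (f x) \<oplus>\<^bsub>Q'\<^esub> g (f y)"
    if "x \<in> C" "f x \<in> P2" "y \<in> C" "f y \<in> P2" for x y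
    using assms(1) that add unfolding quotient_map_def by simp
  moreover have "g (f (a \<odot>\<^bsub>M\<^esub> x)) = a \<odot>\<^bsub>Q'\<^esub> g (f x)"
    if "a \<in> carrier R" "x \<in> C" "f x \<in> P2" for a x
    using assms(1) that smult unfolding quotient_map_def by simp
  moreover have "{x \<in> {x \<in> C. f x \<in> P2}. g (f x) = \<zero>\<^bsub>Q'\<^esub>} = {x \<in> C. f x \<in> P1}"
    using assms(1) unfolding quotient_map_def by blast
  ultimately show ?thesis unfolding quotient_map_def by simp
qed

end

text \<open>The first isomorphism theorem, connecting the coset module with presentations by
  surjections.\<close>

lemma module_isomorphic_quotient_iff:
  assumes "right_module R M" "right_module R Q" "submodule A R M" "submodule C R M" "A \<subseteq> C"
  shows "module_isomorphic R Q (quotient_module (M\<lparr>carrier := C\<rparr>) A) \<longleftrightarrow>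
    (\<exists>f. quotient_map R M A C Q f)"
proof -
  interpret M: right_module R M by fact
  interpret Q: right_module R Q by fact
  let ?X = "quotient_module (M\<lparr>carrier := C\<rparr>) A"
  let ?\<pi> = "\<lambda>x. A +>\<^bsub>M\<^esub> x"
  have coset: "?\<pi> x = {h \<oplus>\<^bsub>M\<^esub> x | h. h \<in> A}" for x unfolding a_r_coset_def' by blast
  have C: "x \<in> carrier M" if "x \<in> C" for x using M.submodule_subset[OF assms(4)] that by blast
  have coset_C: "?\<pi> x \<subseteq> C" if "x \<in> C" for x
    using M.submodule_add[OF assms(4)] that assms(5) unfolding coset by blast
  have self: "x \<in> ?\<pi> x" if "x \<in> C" for x
    unfolding coset using M.submodule_zero[OF assms(3)] C[OF that] by force
  have coset_eq: "?\<pi> y = ?\<pi> x" if "y \<in> ?\<pi> x" "x \<in> C" for x y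
    using M.M.a_repr_independence[of y A x] that C submodule.axioms(1)[OF assms(3)] by metis
  have X_carrier: "carrier ?X = ?\<pi> ` C"
    by (auto simp: quotient_module_def A_RCOSETS_def' a_r_coset_def')
  have X_add: "?\<pi> x \<oplus>\<^bsub>?X\<^esub> ?\<pi> y = ?\<pi> (x \<oplus>\<^bsub>M\<^esub> y)" if "x \<in> C" "y \<in> C" for x y
  proof -
    interpret S: abelian_subgroup A M
      by (rule abelian_subgroupI3)
        (use submodule.axioms(1)[OF assms(3)] M.M.abelian_group_axioms in
          \<open>auto intro: additive_subgroupI\<close>)
    have "?\<pi> x \<oplus>\<^bsub>?X\<^esub> ?\<pi> y = ?\<pi> x <+>\<^bsub>M\<^esub> ?\<pi> y"
      by (simp add: quotient_module_def set_add_def')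
    then show ?thesis using S.a_rcos_sum C that by simp
  qed
  have X_smult: "a \<odot>\<^bsub>?X\<^esub> ?\<pi> x = ?\<pi> (a \<odot>\<^bsub>M\<^esub> x)" if a: "a \<in> carrier R" and x: "x \<in> C" for a x
  proof -
    have const: "?\<pi> (a \<odot>\<^bsub>M\<^esub> y) = ?\<pi> (a \<odot>\<^bsub>M\<^esub> x)" if y: "y \<in> ?\<pi> x" for y
    proof (rule coset_eq)
      obtain h where h: "h \<in> A" "y = h \<oplus>\<^bsub>M\<^esub> x" using y unfolding coset by blast
      then have "a \<odot>\<^bsub>M\<^esub> y = a \<odot>\<^bsub>M\<^esub> h \<oplus>\<^bsub>M\<^esub> a \<odot>\<^bsub>M\<^esub> x"
        using M.smult_r_distr a x C assms(5) by blast
      then show "a \<odot>\<^bsub>M\<^esub> y \<in> ?\<pi> (a \<odot>\<^bsub>M\<^esub> x)"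
        unfolding coset using M.submodule_smult[OF assms(3) a h(1)] by blast
    qed (use M.submodule_smult[OF assms(4)] a x in blast)
    have "a \<odot>\<^bsub>?X\<^esub> ?\<pi> x = (\<Union>y\<in>?\<pi> x. ?\<pi> (a \<odot>\<^bsub>M\<^esub> y))"
      by (simp add: quotient_module_def a_r_coset_def')
    also have "\<dots> = (\<Union>y\<in>?\<pi> x. ?\<pi> (a \<odot>\<^bsub>M\<^esub> x))"
      by (rule SUP_cong[OF refl const])
    also have "\<dots> = ?\<pi> (a \<odot>\<^bsub>M\<^esub> x)"
      using self[OF x] by (subst UN_constant) auto
    finally show ?thesis .
  qed
  have A_eq: "?\<pi> x = A \<longleftrightarrow> x \<in> A" if "x \<in> C" for x
  proof
    show "x \<in> A" if "?\<pi> x = A" using self[OF \<open>x \<in> C\<close>] that by simp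
    show "?\<pi> x = A" if "x \<in> A"
      using M.M.a_coset_join2[of x A] C \<open>x \<in> C\<close> that submodule.axioms(1)[OF assms(3)] by simp
  qed
  show ?thesis
  proof
    assume "module_isomorphic R Q ?X"
    then obtain h where h: "bij_betw h (carrier Q) (carrier ?X)"
        "\<And>x y. \<lbrakk>x \<in> carrier Q; y \<in> carrier Q\<rbrakk> \<Longrightarrow> h (x \<oplus>\<^bsub>Q\<^esub> y) = h x \<oplus>\<^bsub>?X\<^esub> h y"
        "\<And>a x. \<lbrakk>a \<in> carrier R; x \<in> carrier Q\<rbrakk> \<Longrightarrow> h (a \<odot>\<^bsub>Q\<^esub> x) = a \<odot>\<^bsub>?X\<^esub> h x"
      unfolding module_isomorphic_def by blast
    define f where "f x = inv_into (carrier Q) h (?\<pi> x)" for x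
    have f: "f x \<in> carrier Q" "h (f x) = ?\<pi> x" if "x \<in> C" for x
    proof -
      have "?\<pi> x \<in> h ` carrier Q" using h(1) X_carrier that by (simp add: bij_betw_def)
      then show "f x \<in> carrier Q" "h (f x) = ?\<pi> x"
        unfolding f_def by (rule inv_into_into, rule f_inv_into_f)
    qed
    have f_eq: "f x = q" if "x \<in> C" "q \<in> carrier Q" "h q = ?\<pi> x" for x q
      using f[OF that(1)] that h(1) by (metis bij_betw_inv_into_left)
    have f_image: "f ` C = carrier Q"
    proof
      show "carrier Q \<subseteq> f ` C"
      proof
        fix q assume q: "q \<in> carrier Q"
        then have "h q \<in> ?\<pi> ` C" using bij_betwE[OF h(1)] X_carrier by blast
        then obtain x where "x \<in> C" "h q = ?\<pi> x" by blast
        then show "q \<in> f ` C" using f_eq[of x q] q by blast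
      qed
    qed (use f in blast)
    have f_add: "f (x \<oplus>\<^bsub>M\<^esub> y) = f x \<oplus>\<^bsub>Q\<^esub> f y" if "x \<in> C" "y \<in> C" for x y
      using that f h(2) X_add M.submodule_add[OF assms(4)] by (intro f_eq) auto
    have f_smult: "f (a \<odot>\<^bsub>M\<^esub> x) = a \<odot>\<^bsub>Q\<^esub> f x" if "a \<in> carrier R" "x \<in> C" for a x
      using that f h(3) X_smult M.submodule_smult[OF assms(4)] Q.smult_closed
      by (intro f_eq) auto
    have zeroC: "\<zero>\<^bsub>M\<^esub> \<in> C" by (rule M.submodule_zero[OF assms(4)])
    have "f \<zero>\<^bsub>M\<^esub> = f \<zero>\<^bsub>M\<^esub> \<oplus>\<^bsub>Q\<^esub> f \<zero>\<^bsub>M\<^esub>"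
      using f_add[OF zeroC zeroC] by simp
    then have f_zero: "f \<zero>\<^bsub>M\<^esub> = \<zero>\<^bsub>Q\<^esub>"
      using f(1)[OF zeroC] by (metis Q.M.add.l_cancel_one)
    have "f x = \<zero>\<^bsub>Q\<^esub> \<longleftrightarrow> x \<in> A" if x: "x \<in> C" for x
    proof -
      have "f x = \<zero>\<^bsub>Q\<^esub> \<longleftrightarrow> ?\<pi> x = ?\<pi> \<zero>\<^bsub>M\<^esub>"
        using f[OF x] f[OF zeroC] f_zero unfolding f_def by metis
      also have "?\<pi> \<zero>\<^bsub>M\<^esub> = A" using A_eq[OF zeroC] M.submodule_zero[OF assms(3)] by blast
      finally show ?thesis using A_eq[OF x] by simp
    qed
    then have "{x \<in> C. f x = \<zero>\<^bsub>Q\<^esub>} = A" using assms(5) by blast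
    then show "\<exists>f. quotient_map R M A C Q f"
      unfolding quotient_map_def using f_image f_add f_smult by blast
  next
    assume "\<exists>f. quotient_map R M A C Q f"
    then obtain f where "quotient_map R M A C Q f" by blast
    then interpret F: module_quotient R M Q A C f
      by (intro module_quotient.intro module_quotient_axioms.intro assms)
    have f_coset: "f x = f y \<longleftrightarrow> ?\<pi> x = ?\<pi> y" if x: "x \<in> C" and y: "y \<in> C" for x y
    proof
      assume "f x = f y"
      then have "x \<ominus>\<^bsub>M\<^esub> y \<in> A" using F.eq_iff[OF x y] by simp
      moreover have "x = (x \<ominus>\<^bsub>M\<^esub> y) \<oplus>\<^bsub>M\<^esub> y"
        using C x y by (simp add: a_minus_def M.M.a_assoc M.M.l_neg)
      ultimately have "x \<in> ?\<pi> y" unfolding coset by blast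
      then show "?\<pi> x = ?\<pi> y" using coset_eq y by blast
    next
      assume "?\<pi> x = ?\<pi> y"
      then obtain h where h: "h \<in> A" "x = h \<oplus>\<^bsub>M\<^esub> y" using self[OF x] unfolding coset by blast
      have "h \<in> C" "f h = \<zero>\<^bsub>Q\<^esub>" using h(1) F.kernel by auto
      then show "f x = f y" using F.add[of h y] F.closed[OF y] y h(2) by simp
    qed
    define r where "r = inv_into C f"
    have r: "r q \<in> C" "f (r q) = q" if "q \<in> carrier Q" for q
      using F.image that unfolding r_def by (auto intro: inv_into_into f_inv_into_f)
    have "bij_betw (\<lambda>q. ?\<pi> (r q)) (carrier Q) (carrier ?X)"
      unfolding bij_betw_def X_carrier
    proof
      show "inj_on (\<lambda>q. ?\<pi> (r q)) (carrier Q)"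
        by (rule inj_onI) (metis f_coset r)
      show "(\<lambda>q. ?\<pi> (r q)) ` carrier Q = ?\<pi> ` C"
      proof
        show "?\<pi> ` C \<subseteq> (\<lambda>q. ?\<pi> (r q)) ` carrier Q"
        proof
          fix u assume "u \<in> ?\<pi> ` C"
          then obtain x where x: "x \<in> C" "u = ?\<pi> x" by blast
          then have "?\<pi> (r (f x)) = u" using f_coset[of "r (f x)" x] r F.closed by blast
          then show "u \<in> (\<lambda>q. ?\<pi> (r q)) ` carrier Q" using F.closed x by blast
        qed
      qed (use r in blast)
    qed
    moreover have "?\<pi> (r (p \<oplus>\<^bsub>Q\<^esub> q)) = ?\<pi> (r p) \<oplus>\<^bsub>?X\<^esub> ?\<pi> (r q)"
      if "p \<in> carrier Q" "q \<in> carrier Q" for p q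
      using that r F.add X_add M.submodule_add[OF assms(4)]
        f_coset[of "r (p \<oplus>\<^bsub>Q\<^esub> q)" "r p \<oplus>\<^bsub>M\<^esub> r q"] by simp
    moreover have "?\<pi> (r (a \<odot>\<^bsub>Q\<^esub> q)) = a \<odot>\<^bsub>?X\<^esub> ?\<pi> (r q)"
      if "a \<in> carrier R" "q \<in> carrier Q" for a q
      using that r F.smult X_smult M.submodule_smult[OF assms(4)] Q.smult_closed
        f_coset[of "r (a \<odot>\<^bsub>Q\<^esub> q)" "a \<odot>\<^bsub>M\<^esub> r q"] by simp
    ultimately show "module_isomorphic R Q ?X" unfolding module_isomorphic_def by blast
  qed
qed

text \<open>Representatives of the cosets carry a copy of \<open>C / A\<close> on the element type of \<open>M\<close> itself. It
  supplies the factor modules when a bound on deviations is turned into a bound on dimensions.\<close>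

lemma quotient_exists:
  fixes M :: "('r, 'm, 'e) module_scheme"
  assumes "right_module R M" "submodule A R M" "submodule C R M" "A \<subseteq> C"
  obtains Q :: "('r, 'm) module" and f where "right_module R Q" "quotient_map R M A C Q f"
proof -
  interpret M: right_module R M by fact
  have C: "x \<in> carrier M" if "x \<in> C" for x using M.submodule_subset[OF assms(3)] that by blast
  have A: "x \<in> carrier M" "x \<in> C" if "x \<in> A" for x using C assms(4) that by blast+
  define f where "f x = (SOME y. y \<in> A +>\<^bsub>M\<^esub> x)" for x
  have coset: "A +>\<^bsub>M\<^esub> x = {h \<oplus>\<^bsub>M\<^esub> x | h. h \<in> A}" for x unfolding a_r_coset_def' by blast
  have f_ex: "\<exists>h\<in>A. f x = h \<oplus>\<^bsub>M\<^esub> x" if "x \<in> C" for x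
  proof -
    have "\<zero>\<^bsub>M\<^esub> \<oplus>\<^bsub>M\<^esub> x \<in> A +>\<^bsub>M\<^esub> x" using M.submodule_zero[OF assms(2)] unfolding coset by blast
    then have "f x \<in> A +>\<^bsub>M\<^esub> x" unfolding f_def by (rule someI)
    then show ?thesis unfolding coset by blast
  qed
  have f_C: "f x \<in> C" if "x \<in> C" for x
    using f_ex[OF that] M.submodule_add[OF assms(3)] that A by fastforce
  \<comment> \<open>The representative of a coset is chosen from the coset alone, so it does not change when the
    element moves by \<open>A\<close>.\<close>
  have f_shift: "f (h \<oplus>\<^bsub>M\<^esub> x) = f x" if "h \<in> A" "x \<in> C" for h x
  proof -
    have "h \<oplus>\<^bsub>M\<^esub> x \<in> A +>\<^bsub>M\<^esub> x" unfolding coset using that by blast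
    then have "A +>\<^bsub>M\<^esub> (h \<oplus>\<^bsub>M\<^esub> x) = A +>\<^bsub>M\<^esub> x"
      using M.M.a_repr_independence[of "h \<oplus>\<^bsub>M\<^esub> x" A x] that C submodule.axioms(1)[OF assms(2)]
      by metis
    then show ?thesis by (simp add: f_def)
  qed
  have f_f: "f (f x) = f x" if x: "x \<in> C" for x
    using f_ex[OF x] f_shift[OF _ x] by auto
  have f_add: "f (f x \<oplus>\<^bsub>M\<^esub> f y) = f (x \<oplus>\<^bsub>M\<^esub> y)" if x: "x \<in> C" and y: "y \<in> C" for x y
  proof -
    obtain h k where hk: "h \<in> A" "f x = h \<oplus>\<^bsub>M\<^esub> x" "k \<in> A" "f y = k \<oplus>\<^bsub>M\<^esub> y"
      using f_ex x y by meson
    have "f x \<oplus>\<^bsub>M\<^esub> f y = (h \<oplus>\<^bsub>M\<^esub> k) \<oplus>\<^bsub>M\<^esub> (x \<oplus>\<^bsub>M\<^esub> y)"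
      using hk x y A C by (simp add: M.M.a_ac)
    then show ?thesis
      using f_shift[of "h \<oplus>\<^bsub>M\<^esub> k" "x \<oplus>\<^bsub>M\<^esub> y"] hk x y M.submodule_add[OF assms(2)]
        M.submodule_add[OF assms(3)] by simp
  qed
  have f_smult: "f (a \<odot>\<^bsub>M\<^esub> f x) = f (a \<odot>\<^bsub>M\<^esub> x)" if a: "a \<in> carrier R" and x: "x \<in> C" for a x
  proof -
    obtain h where h: "h \<in> A" "f x = h \<oplus>\<^bsub>M\<^esub> x" using f_ex x by meson
    have "a \<odot>\<^bsub>M\<^esub> f x = a \<odot>\<^bsub>M\<^esub> h \<oplus>\<^bsub>M\<^esub> a \<odot>\<^bsub>M\<^esub> x"
      using h a x A C M.smult_r_distr by simp
    then show ?thesis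
      using f_shift[of "a \<odot>\<^bsub>M\<^esub> h" "a \<odot>\<^bsub>M\<^esub> x"] h a x M.submodule_smult[OF assms(2)]
        M.submodule_smult[OF assms(3)] by simp
  qed
  define Q :: "('r, 'm) module" where
    "Q = \<lparr>carrier = f ` C, mult = undefined, one = undefined, zero = f \<zero>\<^bsub>M\<^esub>,
      add = (\<lambda>x y. f (x \<oplus>\<^bsub>M\<^esub> y)), smult = (\<lambda>a x. f (a \<odot>\<^bsub>M\<^esub> x))\<rparr>"
  have Q: "carrier Q = f ` C" "\<zero>\<^bsub>Q\<^esub> = f \<zero>\<^bsub>M\<^esub>"
    "\<And>x y. x \<oplus>\<^bsub>Q\<^esub> y = f (x \<oplus>\<^bsub>M\<^esub> y)" "\<And>a x. a \<odot>\<^bsub>Q\<^esub> x = f (a \<odot>\<^bsub>M\<^esub> x)"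
    by (simp_all add: Q_def)
  have Q_add: "f x \<oplus>\<^bsub>Q\<^esub> f y = f (x \<oplus>\<^bsub>M\<^esub> y)" if "x \<in> C" "y \<in> C" for x y
    using f_add that by (simp add: Q)
  have Q_smult: "a \<odot>\<^bsub>Q\<^esub> f x = f (a \<odot>\<^bsub>M\<^esub> x)" if "a \<in> carrier R" "x \<in> C" for a x
    using f_smult that by (simp add: Q)
  note closed = M.submodule_zero[OF assms(3)] M.submodule_add[OF assms(3)]
    M.submodule_smult[OF assms(3)] M.submodule_uminus[OF assms(3)]
  have "abelian_group Q"
  proof (rule abelian_groupI, unfold Q(1,2))
    fix u assume "u \<in> f ` C"
    then obtain x where x: "x \<in> C" "u = f x" by blast
    have "f (\<ominus>\<^bsub>M\<^esub> x) \<oplus>\<^bsub>Q\<^esub> u = f \<zero>\<^bsub>M\<^esub>" using x C closed Q_add by (simp add: M.M.l_neg)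
    then show "\<exists>y\<in>f ` C. y \<oplus>\<^bsub>Q\<^esub> u = f \<zero>\<^bsub>M\<^esub>" using closed x by blast
  qed (use Q_add closed C M.M.a_assoc M.M.a_comm in auto)
  then have "right_module R Q"
    by (intro right_module.intro right_module_axioms.intro M.R.ring_axioms)
      (use Q_add Q_smult closed C Q(1) in
        \<open>auto simp: M.smult_l_distr M.smult_r_distr M.smult_assoc M.smult_one\<close>)
  moreover have "f x = f \<zero>\<^bsub>M\<^esub> \<longleftrightarrow> x \<in> A" if x: "x \<in> C" for x
  proof
    assume "x \<in> A"
    then have "f (x \<oplus>\<^bsub>M\<^esub> \<zero>\<^bsub>M\<^esub>) = f \<zero>\<^bsub>M\<^esub>" using f_shift closed by blast
    then show "f x = f \<zero>\<^bsub>M\<^esub>" using C x by simp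
  next
    assume eq: "f x = f \<zero>\<^bsub>M\<^esub>"
    obtain h k where hk: "h \<in> A" "f x = h \<oplus>\<^bsub>M\<^esub> x" "k \<in> A" "f \<zero>\<^bsub>M\<^esub> = k \<oplus>\<^bsub>M\<^esub> \<zero>\<^bsub>M\<^esub>"
      using f_ex[OF x] f_ex[OF closed(1)] by meson
    then have "h \<oplus>\<^bsub>M\<^esub> x \<in> A" using eq A by simp
    then show "x \<in> A" using M.submodule_add_cancel[OF assms(2) hk(1) C[OF x]] by simp
  qed
  then have "quotient_map R M A C Q f"
    unfolding quotient_map_def Q(1,2) using Q_add Q_smult assms(4) by auto
  ultimately show ?thesis using that by blast
qed

section \<open>Noetherian dimension as a deviation\<close>

lemma ndim_le_bot:
  assumes "\<forall>\<gamma>. \<alpha> \<le> \<gamma>"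
  shows "ndim_le R M \<alpha> \<longleftrightarrow> carrier M = {\<zero>\<^bsub>M\<^esub>}"
proof -
  have "\<beta> \<le> \<alpha> \<longleftrightarrow> \<beta> = \<alpha>" for \<beta> using assms by (meson antisym order_refl)
  then show ?thesis unfolding ndim_le_def using assms by (simp add: has_ndim.simps[of R M \<alpha>])
qed

text \<open>The condition on ascending chains in the definition of the Noetherian dimension, with the
  factors presented by surjections and with a bound on their dimension in place of its exact value.\<close>

definition chain_condition ::
  "('r, 's) ring_scheme \<Rightarrow> ('r, 'm) module \<Rightarrow> 'o::wellorder \<Rightarrow> bool" where
  "chain_condition R M \<alpha> \<longleftrightarrow>
    (\<forall>C. (\<forall>i. submodule (C i) R M \<and> C i \<subseteq> C (Suc i)) \<longrightarrow>
      (\<exists>k. \<forall>i\<ge>k. \<exists>\<beta><\<alpha>. \<exists>Q :: ('r, 'm) module. \<exists>f.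
        right_module R Q \<and> quotient_map R M (C i) (C (Suc i)) Q f \<and> ndim_le R Q \<beta>))"

lemma has_ndim_iff_chain_condition:
  fixes M :: "('r, 'm) module" and \<alpha> :: "'o::wellorder"
  assumes M: "right_module R M" and \<alpha>: "\<not> (\<forall>\<gamma>. \<alpha> \<le> \<gamma>)"
  shows "has_ndim R M \<alpha> \<longleftrightarrow> \<not> (\<exists>\<beta><\<alpha>. has_ndim R M \<beta>) \<and> chain_condition R M \<alpha>"
proof -
  have step: "(\<exists>\<beta>\<in>{..<\<alpha>}. \<exists>Q :: ('r, 'm) module. right_module R Q \<and>
        module_isomorphic R Q (quotient_module (M\<lparr>carrier := B\<rparr>) A) \<and> has_ndim R Q \<beta>) \<longleftrightarrow>
      (\<exists>\<beta><\<alpha>. \<exists>Q :: ('r, 'm) module. \<exists>f.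
        right_module R Q \<and> quotient_map R M A B Q f \<and> ndim_le R Q \<beta>)" (is "?l \<longleftrightarrow> ?r")
    if AB: "submodule A R M" "submodule B R M" "A \<subseteq> B" for A B
  proof
    assume ?l
    then obtain \<beta> and Q :: "('r, 'm) module" where Q: "\<beta> < \<alpha>" "right_module R Q"
        "module_isomorphic R Q (quotient_module (M\<lparr>carrier := B\<rparr>) A)" "has_ndim R Q \<beta>"
      by blast
    then have "\<exists>f. quotient_map R M A B Q f"
      using module_isomorphic_quotient_iff[OF M Q(2) AB] by simp
    moreover have "ndim_le R Q \<beta>" unfolding ndim_le_def using Q(4) by blast
    ultimately show ?r using Q(1,2) by blast
  next
    assume ?r
    then obtain \<beta> and Q :: "('r, 'm) module" and f where Q: "\<beta> < \<alpha>" "right_module R Q"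
        "quotient_map R M A B Q f" "ndim_le R Q \<beta>"
      by blast
    then obtain \<gamma> where "\<gamma> < \<alpha>" "has_ndim R Q \<gamma>" unfolding ndim_le_def using order_le_less_trans by blast
    moreover have "module_isomorphic R Q (quotient_module (M\<lparr>carrier := B\<rparr>) A)"
      using module_isomorphic_quotient_iff[OF M Q(2) AB] Q(3) by blast
    ultimately show ?l using Q(2) by blast
  qed
  have tail: "(\<exists>k. \<forall>i\<ge>k. \<exists>\<beta>\<in>{..<\<alpha>}. \<exists>Q :: ('r, 'm) module. right_module R Q \<and>
        module_isomorphic R Q (quotient_module (M\<lparr>carrier := C (Suc i)\<rparr>) (C i)) \<and> has_ndim R Q \<beta>) \<longleftrightarrow>
      (\<exists>k. \<forall>i\<ge>k. \<exists>\<beta><\<alpha>. \<exists>Q :: ('r, 'm) module. \<exists>f.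
        right_module R Q \<and> quotient_map R M (C i) (C (Suc i)) Q f \<and> ndim_le R Q \<beta>)"
    if C: "\<forall>i. submodule (C i) R M \<and> C i \<subseteq> C (Suc i)" for C
    using C by (simp only: step simp_thms)
  have chain: "(\<forall>i. submodule (C i) R M) \<and> (\<forall>i. C i \<subseteq> C (Suc i)) \<longleftrightarrow>
      (\<forall>i. submodule (C i) R M \<and> C i \<subseteq> C (Suc i))" for C by blast
  have "(\<forall>C :: nat \<Rightarrow> 'm set.
        (\<forall>i. submodule (C i) R M) \<and> (\<forall>i. C i \<subseteq> C (Suc i)) \<longrightarrow>
        (\<exists>k. \<forall>i\<ge>k. \<exists>\<beta>\<in>{..<\<alpha>}. \<exists>Q :: ('r, 'm) module.
          right_module R Q \<and>
          module_isomorphic R Q (quotient_module (M\<lparr>carrier := C (Suc i)\<rparr>) (C i)) \<and>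
          has_ndim R Q \<beta>)) \<longleftrightarrow> chain_condition R M \<alpha>"
    unfolding chain_condition_def by (intro arg_cong[of _ _ All] ext imp_cong chain tail)
  moreover have "(\<exists>\<beta>\<in>{..<\<alpha>}. has_ndim R M \<beta>) \<longleftrightarrow> (\<exists>\<beta><\<alpha>. has_ndim R M \<beta>)" by auto
  ultimately show ?thesis
    by (subst has_ndim.simps) (simp only: \<alpha> if_False)
qed

lemma chain_condition_mono:
  assumes "chain_condition R M \<alpha>" "\<alpha> \<le> \<alpha>'"
  shows "chain_condition R M \<alpha>'"
  using assms unfolding chain_condition_def by (meson order_less_le_trans)

text \<open>This covers the zero module, whose dimension is \<open>-1\<close> and therefore was not obtained from a
  condition on chains.\<close>

lemma chain_condition_zero:
  fixes M :: "('r, 'm) module" and \<alpha> :: "'o::wellorder"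
  assumes "right_module R M" "carrier M = {\<zero>\<^bsub>M\<^esub>}" "\<not> (\<forall>\<gamma>. \<alpha> \<le> \<gamma>)"
  shows "chain_condition R M \<alpha>"
  unfolding chain_condition_def
proof (intro allI impI)
  interpret right_module R M by fact
  fix C :: "nat \<Rightarrow> 'm set"
  assume C: "\<forall>i. submodule (C i) R M \<and> C i \<subseteq> C (Suc i)"
  have Ci: "C j = {\<zero>\<^bsub>M\<^esub>}" for j
    using submodule_subset[of "C j"] submodule_zero[of "C j"] C assms(2) by blast
  obtain \<beta> where \<beta>: "\<beta> < \<alpha>" "\<forall>\<gamma>. \<beta> \<le> \<gamma>" using assms(3) by (rule not_bot_obtain)
  have "quotient_map R M (C i) (C (Suc i)) M id" for i
    unfolding quotient_map_def Ci using assms(2) by auto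
  moreover have "ndim_le R M \<beta>" using ndim_le_bot[OF \<beta>(2)] assms(2) by blast
  ultimately show "\<exists>k. \<forall>i\<ge>k. \<exists>\<beta><\<alpha>. \<exists>Q :: ('r, 'm) module. \<exists>f.
      right_module R Q \<and> quotient_map R M (C i) (C (Suc i)) Q f \<and> ndim_le R Q \<beta>"
    using \<beta>(1) assms(1) by blast
qed

text \<open>The exact dimension is the least ordinal that satisfies the chain condition, or \<open>-1\<close>. As the
  condition is monotone in the ordinal, the bound is equivalent to the condition.\<close>

lemma ndim_le_iff_chain_condition:
  fixes M :: "('r, 'm) module" and \<alpha> :: "'o::wellorder"
  assumes M: "right_module R M" and \<alpha>: "\<not> (\<forall>\<gamma>. \<alpha> \<le> \<gamma>)"
  shows "ndim_le R M \<alpha> \<longleftrightarrow> chain_condition R M \<alpha>"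
proof
  assume "ndim_le R M \<alpha>"
  then obtain \<beta> where \<beta>: "\<beta> \<le> \<alpha>" "has_ndim R M \<beta>" unfolding ndim_le_def by blast
  show "chain_condition R M \<alpha>"
  proof (cases "\<forall>\<gamma>. \<beta> \<le> \<gamma>")
    case True
    then have "carrier M = {\<zero>\<^bsub>M\<^esub>}" using \<beta>(2) by (simp add: has_ndim.simps[of R M \<beta>])
    then show ?thesis by (rule chain_condition_zero[OF M _ \<alpha>])
  next
    case False
    then show ?thesis
      using \<beta> has_ndim_iff_chain_condition[OF M False] chain_condition_mono by blast
  qed
next
  assume "chain_condition R M \<alpha>"
  then show "ndim_le R M \<alpha>"
    using has_ndim_iff_chain_condition[OF M \<alpha>] unfolding ndim_le_def
    by (meson order_le_less)
qed

text \<open>Images and preimages under \<open>f\<close> match the chains of \<open>Q\<close> with the chains from \<open>A\<close> to \<open>C\<close>.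
  A factor of the one chain is presented, by composition with \<open>f\<close>, as the corresponding factor of
  the other, so the induction hypothesis identifies their bounds. The induction is over all
  quotients of all submodules of \<open>M\<close>, since the factors are of this kind.\<close>

lemma ndim_le_iff_deviation_le:
  fixes M :: "('r, 'm) module" and Q :: "('r, 'm) module" and \<alpha> :: "'o::wellorder"
  assumes "module_quotient R M Q A C f"
  shows "ndim_le R Q \<alpha> \<longleftrightarrow> deviation_le {H. submodule H R M} A C \<alpha>"
  using assms
proof (induction \<alpha> arbitrary: Q A C f rule: less_induct)
  case (less \<alpha>)
  interpret module_quotient R M Q A C f by (rule less.prems)
  let ?L = "{H. submodule H R M}"
  let ?pre = "\<lambda>P. {x \<in> C. f x \<in> P}"
  show ?case
  proof (cases "\<forall>\<gamma>. \<alpha> \<le> \<gamma>")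
    case True
    have "carrier Q = {\<zero>\<^bsub>Q\<^esub>} \<longleftrightarrow> A = C"
    proof
      assume "carrier Q = {\<zero>\<^bsub>Q\<^esub>}"
      then show "A = C" using closed kernel by auto
    next
      assume "A = C"
      then have "\<And>x. x \<in> C \<Longrightarrow> f x = \<zero>\<^bsub>Q\<^esub>" using kernel by blast
      then show "carrier Q = {\<zero>\<^bsub>Q\<^esub>}" using image Q.M.zero_closed by force
    qed
    then show ?thesis using True by (simp add: ndim_le_bot deviation_le_bot)
  next
    case False
    have factor: "(\<exists>Q' :: ('r, 'm) module. \<exists>g.
          right_module R Q' \<and> quotient_map R Q P1 P2 Q' g \<and> ndim_le R Q' \<beta>) \<longleftrightarrow>
        deviation_le ?L (?pre P1) (?pre P2) \<beta>" (is "?l \<longleftrightarrow> ?r")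
      if P: "submodule P1 R Q" "submodule P2 R Q" "P1 \<subseteq> P2" and \<beta>: "\<beta> < \<alpha>" for P1 P2 \<beta>
    proof -
      have sub: "P2 \<subseteq> carrier Q" by (rule Q.submodule_subset[OF P(2)])
      have key: "ndim_le R Q' \<beta> \<longleftrightarrow> ?r"
        if Q': "right_module R Q'" "quotient_map R Q P1 P2 Q' g" for Q' :: "('r, 'm) module" and g
      proof (rule less.IH[OF \<beta>])
        show "module_quotient R M Q' (?pre P1) (?pre P2) (g \<circ> f)"
          using submodule_preimage[OF P(1)] submodule_preimage[OF P(2)]
            quotient_map_comp[OF Q'(2) sub] M.right_module_axioms Q'(1)
          by (intro module_quotient.intro module_quotient_axioms.intro)
      qed
      show ?thesis
      proof
        show ?r if ?l using that key by blast
        show ?l if ?r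
        proof -
          obtain Q' :: "('r, 'm) module" and g where "right_module R Q'" "quotient_map R Q P1 P2 Q' g"
            by (rule quotient_exists[OF Q.right_module_axioms P])
          then show ?l using key that by blast
        qed
      qed
    qed
    have "chain_condition R Q \<alpha> \<longleftrightarrow> deviation_le ?L A C \<alpha>"
    proof
      assume cc: "chain_condition R Q \<alpha>"
      show "deviation_le ?L A C \<alpha>"
      proof (rule deviation_leI[OF False])
        fix D :: "nat \<Rightarrow> 'm set"
        assume D: "\<And>i. D i \<in> ?L" "\<And>i. A \<subseteq> D i" "\<And>i. D i \<subseteq> C" "\<And>i. D i \<subseteq> D (Suc i)"
        have P: "submodule (f ` D i) R Q" "f ` D i \<subseteq> f ` D (Suc i)" for i
          using submodule_image[of "D i"] D(1,3,4)[of i] by (simp_all add: image_mono)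
        have pre: "?pre (f ` D i) = D i" for i using preimage_image[of "D i"] D(1,2,3)[of i] by simp
        obtain k where k: "\<forall>i\<ge>k. \<exists>\<beta><\<alpha>. \<exists>Q' :: ('r, 'm) module. \<exists>g. right_module R Q' \<and>
            quotient_map R Q (f ` D i) (f ` D (Suc i)) Q' g \<and> ndim_le R Q' \<beta>"
          using cc[unfolded chain_condition_def, rule_format, of "\<lambda>i. f ` D i"] P by blast
        have "\<exists>\<beta><\<alpha>. deviation_le ?L (D i) (D (Suc i)) \<beta>" if i: "i \<ge> k" for i
          using k[rule_format, OF i] factor[OF P(1)[of i] P(1)[of "Suc i"] P(2)]
          unfolding pre by blast
        then show "\<exists>k. \<forall>i\<ge>k. \<exists>\<beta><\<alpha>. deviation_le ?L (D i) (D (Suc i)) \<beta>" by blast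
      qed
    next
      assume dev: "deviation_le ?L A C \<alpha>"
      show "chain_condition R Q \<alpha>"
        unfolding chain_condition_def
      proof (intro allI impI)
        fix P :: "nat \<Rightarrow> 'm set"
        assume P: "\<forall>i. submodule (P i) R Q \<and> P i \<subseteq> P (Suc i)"
        have "\<exists>k. \<forall>i\<ge>k. \<exists>\<beta><\<alpha>. deviation_le ?L (?pre (P i)) (?pre (P (Suc i))) \<beta>"
        proof (rule deviation_leD[OF dev False])
          fix i
          show "?pre (P i) \<in> ?L" using submodule_preimage P by simp
          show "A \<subseteq> ?pre (P i)" using kernel Q.submodule_zero[of "P i"] P by auto
          show "?pre (P i) \<subseteq> C" "?pre (P i) \<subseteq> ?pre (P (Suc i))" using P by auto
        qed
        then obtain k where k:
          "\<forall>i\<ge>k. \<exists>\<beta><\<alpha>. deviation_le ?L (?pre (P i)) (?pre (P (Suc i))) \<beta>" ..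
        have "\<exists>\<beta><\<alpha>. \<exists>Q' :: ('r, 'm) module. \<exists>g. right_module R Q' \<and>
            quotient_map R Q (P i) (P (Suc i)) Q' g \<and> ndim_le R Q' \<beta>" if i: "i \<ge> k" for i
          using k[rule_format, OF i] factor[of "P i" "P (Suc i)"] P by blast
        then show "\<exists>k. \<forall>i\<ge>k. \<exists>\<beta><\<alpha>. \<exists>Q' :: ('r, 'm) module. \<exists>g. right_module R Q' \<and>
            quotient_map R Q (P i) (P (Suc i)) Q' g \<and> ndim_le R Q' \<beta>" by blast
      qed
    qed
    then show ?thesis
      using ndim_le_iff_chain_condition[OF Q.right_module_axioms False] by simp
  qed
qed

corollary ndim_le_submodule_iff:
  fixes M :: "('r, 'm) module" and \<alpha> :: "'o::wellorder"
  assumes "right_module R M" "submodule H R M"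
  shows "ndim_le R (M\<lparr>carrier := H\<rparr>) \<alpha> \<longleftrightarrow>
    deviation_le {H. submodule H R M} {\<zero>\<^bsub>M\<^esub>} H \<alpha>"
proof (rule ndim_le_iff_deviation_le)
  interpret right_module R M by fact
  have "quotient_map R M {\<zero>\<^bsub>M\<^esub>} H (M\<lparr>carrier := H\<rparr>) id"
    unfolding quotient_map_def using submodule_zero[OF assms(2)] by auto
  then show "module_quotient R M (M\<lparr>carrier := H\<rparr>) {\<zero>\<^bsub>M\<^esub>} H id"
    using assms submodule_0 right_module_submodule
    by (intro module_quotient.intro module_quotient_axioms.intro) auto
qed

section \<open>Sums of submodules\<close>

context right_module
begin

lemma finsum_mem_submodule:
  assumes "submodule T R M" "finite F" "\<And>\<delta>. \<delta> \<in> F \<Longrightarrow> x \<delta> \<in> T"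
  shows "finsum M x F \<in> T"
  using assms(2,3)
proof (induction F rule: finite_induct)
  case (insert \<delta> F)
  have "x \<in> insert \<delta> F \<rightarrow> carrier M" using insert.prems submodule_subset[OF assms(1)] by blast
  then have "finsum M x (insert \<delta> F) = x \<delta> \<oplus>\<^bsub>M\<^esub> finsum M x F"
    using insert.hyps by (intro M.finsum_insert) auto
  then show ?case using submodule_add[OF assms(1)] insert by simp
qed (simp add: submodule_zero[OF assms(1)])

lemma submodule_sum_least:
  assumes "submodule T R M" "\<And>\<delta>. \<delta> \<in> D \<Longrightarrow> N \<delta> \<subseteq> T"
  shows "submodule_sum M D N \<subseteq> T"
  unfolding submodule_sum_def using finsum_mem_submodule[OF assms(1)] assms(2) by blast

lemma submodule_sum_upper:
  assumes "\<delta> \<in> D" "N \<delta> \<subseteq> carrier M"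
  shows "N \<delta> \<subseteq> submodule_sum M D N"
proof
  fix x assume x: "x \<in> N \<delta>"
  then have "x = finsum M (\<lambda>_. x) {\<delta>}" using assms(2) by auto
  then show "x \<in> submodule_sum M D N"
    unfolding submodule_sum_def using x assms(1) by blast
qed

text \<open>Two finite sums are added over the union of their index sets, after extending both families
  by zero.\<close>

lemma submodule_submodule_sum:
  assumes N: "\<And>\<delta>. \<delta> \<in> D \<Longrightarrow> submodule (N \<delta>) R M"
  shows "submodule (submodule_sum M D N) R M"
  unfolding submodule_iff
proof (intro conjI ballI)
  show "submodule_sum M D N \<subseteq> carrier M"
    using submodule_sum_least[OF submodule_carrier] submodule_subset[OF N] by blast
  have "finite {}" "finsum M (\<lambda>_. \<zero>\<^bsub>M\<^esub>) {} = \<zero>\<^bsub>M\<^esub>" by simp_all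
  then show "\<zero>\<^bsub>M\<^esub> \<in> submodule_sum M D N" unfolding submodule_sum_def by force
next
  fix u v assume "u \<in> submodule_sum M D N" "v \<in> submodule_sum M D N"
  then obtain F x G y where
      u: "u = finsum M x F" "finite F" "F \<subseteq> D" "\<forall>\<delta>\<in>F. x \<delta> \<in> N \<delta>" and
      v: "v = finsum M y G" "finite G" "G \<subseteq> D" "\<forall>\<delta>\<in>G. y \<delta> \<in> N \<delta>"
    unfolding submodule_sum_def by blast
  define x' where "x' \<delta> = (if \<delta> \<in> F then x \<delta> else \<zero>\<^bsub>M\<^esub>)" for \<delta>
  define y' where "y' \<delta> = (if \<delta> \<in> G then y \<delta> else \<zero>\<^bsub>M\<^esub>)" for \<delta>
  have mem: "x' \<delta> \<in> N \<delta>" "y' \<delta> \<in> N \<delta>" if "\<delta> \<in> F \<union> G" for \<delta>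
    using that u v submodule_zero[OF N] by (auto simp: x'_def y'_def)
  have car: "x' \<in> F \<union> G \<rightarrow> carrier M" "y' \<in> F \<union> G \<rightarrow> carrier M"
    using mem submodule_subset[OF N] u(3) v(3) by blast+
  have "u = finsum M x' (F \<union> G)" unfolding u(1)
    by (rule M.add.finprod_mono_neutral_cong_left) (use u v car in \<open>auto simp: x'_def\<close>)
  moreover have "v = finsum M y' (F \<union> G)" unfolding v(1)
    by (rule M.add.finprod_mono_neutral_cong_left) (use u v car in \<open>auto simp: y'_def\<close>)
  ultimately have "u \<oplus>\<^bsub>M\<^esub> v = finsum M (\<lambda>\<delta>. x' \<delta> \<oplus>\<^bsub>M\<^esub> y' \<delta>) (F \<union> G)"
    using M.finsum_addf[OF car] by simp
  moreover have "\<forall>\<delta>\<in>F \<union> G. x' \<delta> \<oplus>\<^bsub>M\<^esub> y' \<delta> \<in> N \<delta>"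
    using mem u(3) v(3) submodule_add[OF N] by blast
  moreover have "finite (F \<union> G)" "F \<union> G \<subseteq> D" using u v by auto
  ultimately show "u \<oplus>\<^bsub>M\<^esub> v \<in> submodule_sum M D N"
    unfolding submodule_sum_def
    by (intro CollectI exI[of _ "F \<union> G"] exI[of _ "\<lambda>\<delta>. x' \<delta> \<oplus>\<^bsub>M\<^esub> y' \<delta>"] conjI)
next
  fix a u assume a: "a \<in> carrier R" and "u \<in> submodule_sum M D N"
  then obtain F x where u: "u = finsum M x F" "finite F" "F \<subseteq> D" "\<forall>\<delta>\<in>F. x \<delta> \<in> N \<delta>"
    unfolding submodule_sum_def by blast
  have car: "x \<in> F \<rightarrow> carrier M" using u(3,4) submodule_subset[OF N] by blast
  have "a \<odot>\<^bsub>M\<^esub> finsum M x F = finsum M (\<lambda>\<delta>. a \<odot>\<^bsub>M\<^esub> x \<delta>) F"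
    using u(2) car
  proof (induction F rule: finite_induct)
    case (insert \<delta> F)
    have "a \<odot>\<^bsub>M\<^esub> finsum M x (insert \<delta> F) = a \<odot>\<^bsub>M\<^esub> (x \<delta> \<oplus>\<^bsub>M\<^esub> finsum M x F)"
      using insert by (subst M.finsum_insert) auto
    also have "\<dots> = a \<odot>\<^bsub>M\<^esub> x \<delta> \<oplus>\<^bsub>M\<^esub> a \<odot>\<^bsub>M\<^esub> finsum M x F"
      using insert.prems a by (intro smult_r_distr M.finsum_closed) auto
    also have "\<dots> = finsum M (\<lambda>\<delta>. a \<odot>\<^bsub>M\<^esub> x \<delta>) (insert \<delta> F)"
      using insert a smult_closed by (subst M.finsum_insert) (auto simp: Pi_iff)
    finally show ?case .
  qed (simp add: smult_zero a)
  moreover have "\<forall>\<delta>\<in>F. a \<odot>\<^bsub>M\<^esub> x \<delta> \<in> N \<delta>" using u(3,4) submodule_smult[OF N] a by blast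
  ultimately show "a \<odot>\<^bsub>M\<^esub> u \<in> submodule_sum M D N"
    unfolding submodule_sum_def using u(1-3)
    by (intro CollectI exI[of _ F] exI[of _ "\<lambda>\<delta>. a \<odot>\<^bsub>M\<^esub> x \<delta>"] conjI) simp_all
qed

lemma submodule_sum_mono:
  assumes "\<And>\<delta>. \<delta> \<in> E \<Longrightarrow> submodule (N \<delta>) R M" "D \<subseteq> E"
  shows "submodule_sum M D N \<subseteq> submodule_sum M E N"
proof (rule submodule_sum_least)
  show "submodule (submodule_sum M E N) R M" using assms(1) by (rule submodule_submodule_sum)
  show "N \<delta> \<subseteq> submodule_sum M E N" if "\<delta> \<in> D" for \<delta>
    by (rule submodule_sum_upper) (use that assms submodule_subset in auto)
qed

lemma submodule_sum_split:
  assumes N: "\<And>\<delta>. \<delta> \<in> D \<union> E \<Longrightarrow> submodule (N \<delta>) R M"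
  shows "submodule_sum M (D \<union> E) N \<subseteq> submodule_sum M D N <+>\<^bsub>M\<^esub> submodule_sum M E N"
proof (rule submodule_sum_least)
  interpret modular_family "{H. submodule H R M}" "\<lambda>A B. A <+>\<^bsub>M\<^esub> B"
    by (rule modular_family_submodules)
  have D: "submodule (submodule_sum M D N) R M" and E: "submodule (submodule_sum M E N) R M"
    using N by (auto intro: submodule_submodule_sum)
  then show "submodule (submodule_sum M D N <+>\<^bsub>M\<^esub> submodule_sum M E N) R M"
    by (rule submodule_set_add)
  fix \<delta> assume \<delta>: "\<delta> \<in> D \<union> E"
  then have "N \<delta> \<subseteq> submodule_sum M D N \<or> N \<delta> \<subseteq> submodule_sum M E N"
    using submodule_sum_upper[of \<delta> _ N] submodule_subset[OF N[OF \<delta>]] \<delta> by auto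
  then show "N \<delta> \<subseteq> submodule_sum M D N <+>\<^bsub>M\<^esub> submodule_sum M E N"
    using join_upper1[of "submodule_sum M D N" "submodule_sum M E N"]
      join_upper2[of "submodule_sum M D N" "submodule_sum M E N"] D E by auto
qed

text \<open>An infinite irredundant family would give a strictly descending sequence of non-small
  submodules: the sums \<open>K n\<close> of the members that remain after the first \<open>n\<close> terms of a sequence of
  distinct indices are left out.\<close>

lemma fsd_irredundant_sum_finite:
  assumes fsd: "finite_spanning_dimension R M"
    and N: "\<And>\<delta>. \<delta> \<in> \<Delta> \<Longrightarrow> submodule (N \<delta>) R M"
    and irr: "is_irredundant_sum M \<Delta> N"
  shows "finite \<Delta>"
proof (rule ccontr)
  assume "infinite \<Delta>"
  then obtain g :: "nat \<Rightarrow> _" where g: "inj g" "range g \<subseteq> \<Delta>"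
    using infinite_countable_subset by blast
  let ?S = "\<lambda>D. submodule_sum M D N"
  have sum: "carrier M = ?S \<Delta>" and irr': "\<And>\<delta>. \<delta> \<in> \<Delta> \<Longrightarrow> carrier M \<noteq> ?S (\<Delta> - {\<delta>})"
    using irr unfolding is_irredundant_sum_def by blast+
  have S: "submodule (?S D) R M" if "D \<subseteq> \<Delta>" for D
    using N that by (blast intro: submodule_submodule_sum)
  have mono: "?S D \<subseteq> ?S E" if "D \<subseteq> E" "E \<subseteq> \<Delta>" for D E
    using submodule_sum_mono N that by (meson subsetD)
  have not_all: "\<not> carrier M \<subseteq> ?S D" if "D \<subseteq> \<Delta> - {\<delta>}" "\<delta> \<in> \<Delta>" for D \<delta>
    using mono[OF that(1)] irr'[OF that(2)] submodule_subset[OF S[of "\<Delta> - {\<delta>}"]] by blast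
  define K where "K n = ?S (\<Delta> - g ` {..<n})" for n
  \<comment> \<open>The finitely many omitted members complement \<open>K n\<close>, yet they miss \<open>g n\<close> and so do not span.\<close>
  have small: "\<not> small_submodule R M (K n)" for n
  proof
    assume "small_submodule R M (K n)"
    moreover have F: "g ` {..<n} \<subseteq> \<Delta> - {g n}" using g by (auto simp: inj_eq)
    moreover have "K n <+>\<^bsub>M\<^esub> ?S (g ` {..<n}) = carrier M"
    proof
      have "(\<Delta> - g ` {..<n}) \<union> g ` {..<n} = \<Delta>" using F by blast
      then show "carrier M \<subseteq> K n <+>\<^bsub>M\<^esub> ?S (g ` {..<n})"
        using submodule_sum_split[of "\<Delta> - g ` {..<n}" "g ` {..<n}" N] N unfolding sum K_def by simp
      show "K n <+>\<^bsub>M\<^esub> ?S (g ` {..<n}) \<subseteq> carrier M"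
        unfolding K_def using F by (intro submodule_subset submodule_set_add S) auto
    qed
    ultimately have "?S (g ` {..<n}) = carrier M"
      unfolding small_submodule_def using S[of "g ` {..<n}"] by blast
    then show False using not_all[OF F] g(2) by blast
  qed
  have "submodule (K n) R M" "K (Suc n) \<subseteq> K n" for n
    unfolding K_def by (intro S mono; auto)+
  then obtain n where n: "K (Suc n) = K n"
    using fsd[unfolded finite_spanning_dimension_def, rule_format, of K] small by (metis le_SucI order_refl)
  \<comment> \<open>A stationary step puts the member \<open>g n\<close> into the sum of the others, against irredundancy.\<close>
  have gn: "g n \<in> \<Delta> - g ` {..<n}" "g n \<in> \<Delta>" using g by (auto simp: inj_eq)
  have "N (g n) \<subseteq> K n"
    unfolding K_def by (rule submodule_sum_upper[where N = N, OF gn(1) submodule_subset[OF N[OF gn(2)]]])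
  also have "\<dots> = K (Suc n)" using n by simp
  also have "\<dots> \<subseteq> ?S (\<Delta> - {g n})" unfolding K_def by (rule mono) auto
  finally have gn_in: "N (g n) \<subseteq> ?S (\<Delta> - {g n})" .
  have "?S \<Delta> \<subseteq> ?S (\<Delta> - {g n})"
  proof (rule submodule_sum_least[OF S])
    fix \<delta> assume \<delta>: "\<delta> \<in> \<Delta>"
    show "N \<delta> \<subseteq> ?S (\<Delta> - {g n})"
    proof (cases "\<delta> = g n")
      case False
      then show ?thesis using submodule_sum_upper[of \<delta> "\<Delta> - {g n}" N] submodule_subset[OF N[OF \<delta>]] \<delta>
        by blast
    qed (use gn_in in simp)
  qed auto
  then show False using not_all[OF order_refl gn(2)] sum by simp
qed

lemma deviation_le_submodule_sum:
  assumes "finite D" "\<And>\<delta>. \<delta> \<in> D \<Longrightarrow> submodule (N \<delta>) R M"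
    and "\<And>\<delta>. \<delta> \<in> D \<Longrightarrow> deviation_le {H. submodule H R M} {\<zero>\<^bsub>M\<^esub>} (N \<delta>) \<alpha>"
  shows "deviation_le {H. submodule H R M} {\<zero>\<^bsub>M\<^esub>} (submodule_sum M D N) \<alpha>"
  using assms
proof (induction D rule: finite_induct)
  case empty
  have "submodule_sum M {} N = {\<zero>\<^bsub>M\<^esub>}"
    unfolding submodule_sum_def by auto
  then show ?case by (simp add: deviation_le_refl)
next
  case (insert \<delta> D)
  interpret modular_family "{H. submodule H R M}" "\<lambda>A B. A <+>\<^bsub>M\<^esub> B"
    by (rule modular_family_submodules)
  note N = insert.prems(1)
  let ?S = "submodule_sum M D N"
  have S: "submodule ?S R M" using N by (blast intro: submodule_submodule_sum)
  have \<delta>: "submodule (N \<delta>) R M" using N by blast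
  have "deviation_le {H. submodule H R M} {\<zero>\<^bsub>M\<^esub>} (N \<delta> <+>\<^bsub>M\<^esub> ?S) \<alpha>"
    using insert S \<delta> submodule_0 submodule_zero by (intro deviation_le_join) auto
  moreover have "submodule_sum M (insert \<delta> D) N \<subseteq> N \<delta> <+>\<^bsub>M\<^esub> ?S"
  proof (rule submodule_sum_least)
    show "submodule (N \<delta> <+>\<^bsub>M\<^esub> ?S) R M" using \<delta> S by (rule submodule_set_add)
    fix \<epsilon> assume "\<epsilon> \<in> insert \<delta> D"
    then have "N \<epsilon> \<subseteq> N \<delta> \<or> N \<epsilon> \<subseteq> ?S"
      using submodule_sum_upper[of \<epsilon> D N] submodule_subset[OF N, of \<epsilon>] by auto
    then show "N \<epsilon> \<subseteq> N \<delta> <+>\<^bsub>M\<^esub> ?S"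
      using join_upper1[of "N \<delta>" ?S] join_upper2[of "N \<delta>" ?S] \<delta> S by auto
  qed
  moreover have "{\<zero>\<^bsub>M\<^esub>} \<subseteq> submodule_sum M (insert \<delta> D) N"
    using submodule_zero[OF submodule_submodule_sum[of "insert \<delta> D" N]] N by simp
  ultimately show ?case by (blast intro: deviation_le_subinterval)
qed

end

theorem theorem2p3:
  fixes R :: "('r, 's) ring_scheme"
    and M :: "('r, 'm) module"
    and \<Delta> :: "'i set"
    and N :: "'i \<Rightarrow> 'm set"
    and \<alpha> :: "'o::wellorder"
  assumes "ring R"
    and "right_module R M"
    and "finite_spanning_dimension R M"
    and "\<And>\<delta>. \<delta> \<in> \<Delta> \<Longrightarrow> submodule (N \<delta>) R M"
    and "is_irredundant_sum M \<Delta> N"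
    and "\<And>\<delta>. \<delta> \<in> \<Delta> \<Longrightarrow> ndim_le R (M\<lparr>carrier := N \<delta>\<rparr>) \<alpha>"
  shows "ndim_le R M \<alpha>"
proof -
  interpret right_module R M by fact
  let ?L = "{H. submodule H R M}"
  have "finite \<Delta>"
    using assms(3-5) by (rule fsd_irredundant_sum_finite)
  moreover have "deviation_le ?L {\<zero>\<^bsub>M\<^esub>} (N \<delta>) \<alpha>" if "\<delta> \<in> \<Delta>" for \<delta>
    using ndim_le_submodule_iff[OF assms(2) assms(4)[OF that], of \<alpha>] assms(6)[OF that] by blast
  ultimately have "deviation_le ?L {\<zero>\<^bsub>M\<^esub>} (submodule_sum M \<Delta> N) \<alpha>"
    using assms(4) by (intro deviation_le_submodule_sum)
  also have "submodule_sum M \<Delta> N = carrier M"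
    using assms(5) unfolding is_irredundant_sum_def by simp
  finally show ?thesis
    using ndim_le_submodule_iff[OF assms(2) submodule_carrier, of \<alpha>] by simp
qed

end
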